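(* Let $f(t)$, $g(t)$, $h(t)$ be convergent real power series satisfying: (1) $f(t)=1+O(t)$, $h(t)=1+O(t)$, $g(t)=t+O(t^2)$; (2) $f\succeq 0$ and $1/g\succeq 0$ (here $1/g$ is a Laurent series); (3) $Lg(t):=t g'(t)/g(t)$ has a positive real zero; let $t_0$ denote the smallest such zero; (4) $f$, $1/g$, $f/h$ and $f'/h$ have radius of convergence $>t_0$; (5) $1/h$ is positive on $[0,t_0]$. For each integer $m\ge 0$, let $d_m$ be the maximum of $\nu(A-1)$, where $A$ ranges over power series with $A\succeq 0$ of the form \[ A(t)=h(t)\sum_{0\le i\le m} c_i f(t)^{m-i} g(t)^i \] with real coefficients $c_i$. Let $0<t'_0<t_0$ be such that $f(t'_0)/g(t'_0)=f(t_0)/g(t_0)$. Then \[ \limsup_{m\to\infty} \frac{d_m}{m}\le Lg(t'_0). \]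
   Context: For a (Laurent) series $p(t)$, $[t^j]p(t)$ denotes the coefficient of $t^j$. For Laurent series $f,g$, $f\succeq g$ means $[t^j](f(t)-g(t))\ge 0$ for all $j$. For a power series (or left-finite Laurent series) $p$, the valuation $\nu(p)$ is the exponent of the first nonzero term of $p$. *)

theory Defs
  imports "HOL-Complex_Analysis.Complex_Analysis"
begin

definition fls_succeq :: "real fls \<Rightarrow> real fls \<Rightarrow> bool" (infix "\<succeq>" 50) where
  "p \<succeq> q \<longleftrightarrow> (\<forall>j::int. fls_nth (p - q) j \<ge> 0)"

definition valuation :: "real fps \<Rightarrow> enat" where
  "valuation p = (if p = 0 then \<infinity> else enat (subdegree p))"

text \<open>\<open>Lg = t g'(t) / g(t)\<close>, with the quotient taken in the ring of formal power series; it is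
  exact when \<open>g = t + O(t^2)\<close>, and then \<open>Lg = 1 + O(t)\<close>.\<close>
definition log_deriv :: "real fps \<Rightarrow> real fps" where
  "log_deriv g = fps_X * fps_deriv g / g"

definition complex_fps :: "real fps \<Rightarrow> complex fps" where
  "complex_fps p = Abs_fps (\<lambda>n. complex_of_real (fps_nth p n))"

text \<open>The analytic continuation of the power series \<open>p\<close> along the segment \<open>[0, t]\<close> exists and
  takes the value \<open>v\<close> at \<open>t\<close>.\<close>
definition continues_to :: "real fps \<Rightarrow> real \<Rightarrow> real \<Rightarrow> bool" where
  "continues_to p t v \<longleftrightarrow>
     (\<exists>S F. open S \<and> closed_segment 0 (complex_of_real t) \<subseteq> S \<and> F holomorphic_on S \<and>
            F has_fps_expansion complex_fps p \<and> F (complex_of_real t) = complex_of_real v)"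

text \<open>The value of \<open>p\<close> at a real point \<open>t\<close>. Summing the series is not enough here: if only
  \<open>1/g\<close> is known to converge at \<open>t\<close>, then \<open>g\<close> and \<open>Lg\<close> need not converge there. For
  example, \<open>g = t / (1 + t^2)\<close> has \<open>1/g = 1/t + t\<close> and \<open>Lg = (1 - t^2) / (1 + t^2)\<close>, whose
  zero \<open>t = 1\<close> lies on the boundary of the disc of convergence of \<open>g\<close> and \<open>Lg\<close>. It is proved
  below that the value is unique when the continuation exists and that it agrees with the sum
  of the series inside the disc of convergence. If \<open>f = 1 + O(t)\<close>, \<open>g = t + O(t^2)\<close>,
  \<open>f \<succeq> 0\<close>, \<open>1/g \<succeq> 0\<close> and \<open>f\<close>, \<open>1/g\<close>, \<open>f/h\<close> have radius of convergence greater than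
  \<open>t0\<close>, then \<open>f\<close> and \<open>1/g\<close> have no zeros on \<open>(0, t0]\<close>, so the continuations of \<open>g\<close>, \<open>Lg\<close>
  and \<open>1/h = (f/h)/f\<close> along \<open>[0, t0]\<close> exist.\<close>
definition value_at :: "real fps \<Rightarrow> real \<Rightarrow> real" where
  "value_at p t = (THE v. continues_to p t v)"

lemma continues_to_unique:
  assumes "continues_to p t v" "continues_to p t w"
  shows "v = w"
proof -
  obtain S F where S: "open S" "closed_segment 0 (complex_of_real t) \<subseteq> S" "F holomorphic_on S"
    "F has_fps_expansion complex_fps p" "F (complex_of_real t) = complex_of_real v"
    using assms(1) unfolding continues_to_def by blast
  obtain T G where T: "open T" "closed_segment 0 (complex_of_real t) \<subseteq> T" "G holomorphic_on T"
    "G has_fps_expansion complex_fps p" "G (complex_of_real t) = complex_of_real w"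
    using assms(2) unfolding continues_to_def by blast
  define C where "C = connected_component_set (S \<inter> T) (0::complex)"
  have C: "open C" "connected C"
    unfolding C_def using S(1) T(1) by (simp_all add: open_connected_component open_Int)
  have CST: "C \<subseteq> S \<inter> T"
    unfolding C_def by (rule connected_component_subset)
  have seg: "closed_segment 0 (complex_of_real t) \<subseteq> C"
    unfolding C_def using S T by (intro connected_component_maximal) auto
  have "eventually (\<lambda>z. F z = G z) (nhds 0)"
    using S(4) T(4) unfolding has_fps_expansion_def
    by (auto elim: eventually_elim2)
  then obtain U where U: "open U" "0 \<in> U" "\<And>z. z \<in> U \<Longrightarrow> F z = G z"
    unfolding eventually_nhds by blast
  have "F (complex_of_real t) = G (complex_of_real t)"
  proof (rule analytic_continuation_open[of "U \<inter> C" C F G])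
    show "open (U \<inter> C)" "open C" "connected C" "U \<inter> C \<subseteq> C" using U C by auto
    show "U \<inter> C \<noteq> {}" using U seg by auto
    show "F holomorphic_on C" "G holomorphic_on C"
      using S T CST by (auto intro: holomorphic_on_subset)
    show "complex_of_real t \<in> C" using seg by auto
  qed (use U in auto)
  thus ?thesis using S T by simp
qed

lemma value_at_eqI: "continues_to p t v \<Longrightarrow> value_at p t = v"
  unfolding value_at_def by (blast intro: the_equality continues_to_unique)

lemma value_at_eq_eval_fps:
  assumes "ereal \<bar>t\<bar> < fps_conv_radius p"
  shows "value_at p t = eval_fps p t"
proof -
  have rad: "fps_conv_radius (complex_fps p) = fps_conv_radius p"
    unfolding fps_conv_radius_def conv_radius_def complex_fps_def by simp
  have sums: "(\<lambda>n. fps_nth p n * t ^ n) sums eval_fps p t"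
    using assms by (intro sums_eval_fps) simp
  have "(\<lambda>n. complex_of_real (fps_nth p n * t ^ n)) sums complex_of_real (eval_fps p t)"
    using sums by (rule sums_of_real)
  hence ev: "eval_fps (complex_fps p) (complex_of_real t) = complex_of_real (eval_fps p t)"
    unfolding eval_fps_def complex_fps_def by (simp add: sums_iff)
  have pos: "fps_conv_radius (complex_fps p) > 0"
    unfolding rad using assms by (metis abs_ge_zero ereal_less_eq(5) le_less_trans)
  have "closed_segment 0 (complex_of_real t) \<subseteq> eball 0 (fps_conv_radius (complex_fps p))"
  proof
    fix z assume "z \<in> closed_segment 0 (complex_of_real t)"
    hence "norm z \<le> \<bar>t\<bar>"
      using segment_bound1[of z 0 "complex_of_real t"] by simp
    thus "z \<in> eball 0 (fps_conv_radius (complex_fps p))"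
      using assms rad by (auto simp: in_eball_iff intro: le_less_trans[of _ "ereal \<bar>t\<bar>"])
  qed
  moreover have "eval_fps (complex_fps p) has_fps_expansion complex_fps p"
    using pos by (simp add: has_fps_expansion_def)
  ultimately have "continues_to p t (eval_fps p t)"
    unfolding continues_to_def using ev holomorphic_on_eval_fps open_eball by blast
  thus ?thesis by (rule value_at_eqI)
qed

text \<open>The space of all \<open>A = h \<Sum> c\<^sub>i f^(m-i) g^i\<close> with real coefficients and \<open>A \<succeq> 0\<close>.\<close>
definition admissible :: "real fps \<Rightarrow> real fps \<Rightarrow> real fps \<Rightarrow> nat \<Rightarrow> real fps set" where
  "admissible f g h m =
     {A. (\<exists>c :: nat \<Rightarrow> real. A = h * (\<Sum>i\<le>m. fps_const (c i) * f ^ (m - i) * g ^ i)) \<and>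
         fps_to_fls A \<succeq> 0}"

text \<open>If \<open>f = 1 + O(t)\<close>, \<open>h = 1 + O(t)\<close> and \<open>g = t + O(t^2)\<close>, the supremum is a maximum: the
  set of valuations is nonempty because \<open>A = 0\<close> is admissible, and finite because the conditions
  \<open>\<nu>(A - 1) \<ge> m + 1\<close> determine the coefficients \<open>c\<^sub>0, \<dots>, c\<^sub>m\<close> one after the other.\<close>
definition max_order :: "real fps \<Rightarrow> real fps \<Rightarrow> real fps \<Rightarrow> nat \<Rightarrow> enat" where
  "max_order f g h m = (SUP A \<in> admissible f g h m. valuation (A - 1))"

end

theory Submission
  imports Defs
begin

text \<open>
  Put \<open>u = t/g\<close>, \<open>v = f u\<close> and \<open>y = f/g = v/t\<close>, so that \<open>Lg = 1 - Lu\<close> with \<open>Lu = t u'/u\<close>. If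
  \<open>A\<close> is admissible and \<open>Q\<close> is a polynomial, then \<open>- A Q(y) y' / (h g\<^sup>m)\<close> is the derivative of a
  polynomial in \<open>y\<close>, so its residue vanishes. This is a linear
  relation \<open>\<Sum>\<^sub>j A\<^sub>j w\<^sub>j = 0\<close> in which \<open>w\<^sub>j\<close> is a coefficient of \<open>\<phi> u\<^sup>m\<close> for a fixed series \<open>\<phi>\<close>; its
  sign is governed by the sign of \<open>\<phi>\<close> at the saddle point \<open>r\<close> with \<open>Lg(r) = j/m\<close>. The choice
  \<open>Q(y) = (y - w)(y + 1)\<^sup>K\<close>, with \<open>w\<close> slightly larger than \<open>y(t\<^sub>0) = y(t\<^sub>0')\<close>, makes \<open>\<phi>\<close> positive at
  \<open>t\<^sub>0\<close> (so \<open>w\<^sub>0 > 0\<close>) and on \<open>(0, r]\<close> for some \<open>r < t\<^sub>0'\<close> close to \<open>t\<^sub>0'\<close> (so \<open>w\<^sub>j \<ge> 0\<close> for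
  \<open>j \<ge> (Lg(t\<^sub>0') + \<epsilon>) m\<close>). As \<open>A = 1 + O(t\<^sup>d)\<close> and \<open>A \<succeq> 0\<close>, this is impossible for
  \<open>d > (Lg(t\<^sub>0') + \<epsilon>) m\<close>.

  The signs are found without contour integrals. For \<open>\<kappa> = Lu(r) \<le> 1\<close> the series \<open>u - t u'/\<kappa>\<close> is
  \<open>1 - a\<close>, where \<open>a \<succeq> 0\<close> and \<open>a(r) = 1\<close>, so \<open>1/(1 - a)\<close> is the generating function of a renewal
  process, and the coefficients of \<open>(1 - a) u\<^sup>m\<close> are those of \<open>u\<^sup>m\<^sup>+\<^sup>1\<close> times \<open>1 - n/(\<kappa>(m+1))\<close>. Hence
  it suffices that \<open>\<phi>/(1 - a)\<close> has positive coefficients, apart from finitely many. The factor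
  \<open>(v + t)\<^sup>K\<close> of \<open>\<phi>\<close> has positive constant and linear coefficients and therefore, for large \<open>K\<close>,
  smooths out any periodicity of \<open>u\<close>. For small \<open>r\<close> it makes all the coefficients of
  \<open>\<phi>/(1 - a)\<close> nonnegative, which settles the range where saddle points approach \<open>0\<close>.
\<close>

subsection \<open>The sum of absolute coefficients\<close>

definition l1 :: "real fps \<Rightarrow> bool" where
  "l1 p \<longleftrightarrow> summable (\<lambda>n. \<bar>fps_nth p n\<bar>)"

definition l1_norm :: "real fps \<Rightarrow> real" where
  "l1_norm p = (\<Sum>n. \<bar>fps_nth p n\<bar>)"

lemma l1_norm_nonneg: "l1 p \<Longrightarrow> 0 \<le> l1_norm p"
  unfolding l1_def l1_norm_def by (rule suminf_nonneg) auto

lemma sum_le_l1_norm: "l1 p \<Longrightarrow> finite I \<Longrightarrow> (\<Sum>n\<in>I. \<bar>fps_nth p n\<bar>) \<le> l1_norm p"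
  unfolding l1_def l1_norm_def by (rule sum_le_suminf) auto

lemma abs_fps_mult_nth_le:
  "\<bar>fps_nth (p * q) n\<bar> \<le> (\<Sum>i\<le>n. \<bar>fps_nth p i\<bar> * \<bar>fps_nth (q :: real fps) (n - i)\<bar>)"
  unfolding fps_mult_nth abs_mult[symmetric] atLeast0AtMost by (rule sum_abs)

lemma
  assumes "l1 p" "l1 q"
  shows l1_mult: "l1 (p * q)" and l1_norm_mult_le: "l1_norm (p * q) \<le> l1_norm p * l1_norm q"
proof -
  have *: "(\<lambda>n. \<Sum>i\<le>n. \<bar>fps_nth p i\<bar> * \<bar>fps_nth q (n - i)\<bar>) sums (l1_norm p * l1_norm q)"
    unfolding l1_norm_def using assms unfolding l1_def
    by (intro Cauchy_product_sums) auto
  show 1: "l1 (p * q)"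
    unfolding l1_def
    by (rule summable_comparison_test_ev[OF _ sums_summable[OF *]])
       (auto intro!: always_eventually abs_fps_mult_nth_le)
  show "l1_norm (p * q) \<le> l1_norm p * l1_norm q"
    using 1 unfolding l1_def
    by (subst sums_unique[OF *], subst l1_norm_def)
       (intro suminf_le abs_fps_mult_nth_le sums_summable[OF *])
qed

lemma
  assumes "l1 p" "l1 q"
  shows l1_add: "l1 (p + q)" and l1_norm_add_le: "l1_norm (p + q) \<le> l1_norm p + l1_norm q"
proof -
  have s: "summable (\<lambda>n. \<bar>fps_nth p n\<bar> + \<bar>fps_nth q n\<bar>)"
    using assms unfolding l1_def by (rule summable_add)
  show 1: "l1 (p + q)"
    unfolding l1_def by (rule summable_comparison_test_ev[OF _ s]) (auto intro!: always_eventually)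
  show "l1_norm (p + q) \<le> l1_norm p + l1_norm q"
    using 1 assms s unfolding l1_def l1_norm_def
    by (subst suminf_add) (auto intro!: suminf_le)
qed

lemma l1_const [simp]: "l1 (fps_const c)" and l1_norm_const [simp]: "l1_norm (fps_const c) = \<bar>c\<bar>"
proof -
  have "(\<lambda>n. \<bar>fps_nth (fps_const c) n\<bar>) sums \<bar>c\<bar>"
    using sums_If_finite_set[of "{0}" "\<lambda>_. \<bar>c\<bar>"] by (auto simp: if_distrib cong: if_cong)
  thus "l1 (fps_const c)" "l1_norm (fps_const c) = \<bar>c\<bar>"
    unfolding l1_def l1_norm_def by (auto simp: sums_iff)
qed

lemma l1_1 [simp]: "l1 1" and l1_norm_1 [simp]: "l1_norm 1 = 1"
  using l1_const[of 1] l1_norm_const[of 1] by simp_all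

lemma l1_power: "l1 p \<Longrightarrow> l1 (p ^ n)"
  by (induction n) (auto intro: l1_mult)

lemma l1_norm_power_le: "l1 p \<Longrightarrow> l1_norm (p ^ n) \<le> l1_norm p ^ n"
proof (induction n)
  case (Suc n)
  have "l1_norm (p * p ^ n) \<le> l1_norm p * l1_norm (p ^ n)"
    using Suc l1_power by (intro l1_norm_mult_le) auto
  also have "\<dots> \<le> l1_norm p * l1_norm p ^ n"
    using Suc l1_norm_nonneg by (intro mult_left_mono) auto
  finally show ?case by simp
qed simp

lemma l1_norm_sum_le:
  assumes "finite I" "\<And>i. i \<in> I \<Longrightarrow> l1 (p i)"
  shows "l1_norm (\<Sum>i\<in>I. p i) \<le> (\<Sum>i\<in>I. l1_norm (p i))"
proof -
  have "l1 (\<Sum>i\<in>I. p i) \<and> l1_norm (\<Sum>i\<in>I. p i) \<le> (\<Sum>i\<in>I. l1_norm (p i))"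
    using assms
  proof (induction I rule: finite_induct)
    case empty
    show ?case using l1_const[of 0] l1_norm_const[of 0] by simp
  next
    case (insert x I)
    then show ?case
      using l1_add[of "p x" "sum p I"] l1_norm_add_le[of "p x" "sum p I"] by auto
  qed
  thus ?thesis by blast
qed

text \<open>Applied with a renewal sequence as \<open>d\<close>: such a sequence is bounded by 1 but
  need not be summable, so products with it are controlled coefficientwise and not in
  \<open>l1_norm\<close>.\<close>

lemma abs_mult_nth_le_l1_norm:
  assumes "l1 p" "\<And>n. \<bar>fps_nth d n\<bar> \<le> (1::real)"
  shows "\<bar>fps_nth (p * d) n\<bar> \<le> l1_norm p"
proof -
  have "\<bar>fps_nth (p * d) n\<bar> \<le> (\<Sum>i\<le>n. \<bar>fps_nth p i\<bar> * \<bar>fps_nth d (n - i)\<bar>)"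
    by (rule abs_fps_mult_nth_le)
  also have "\<dots> \<le> (\<Sum>i\<le>n. \<bar>fps_nth p i\<bar> * 1)"
    using assms(2) by (intro sum_mono mult_left_mono) auto
  also have "\<dots> \<le> l1_norm p" using sum_le_l1_norm[OF assms(1), of "{..n}"] by simp
  finally show ?thesis .
qed

section \<open>Coefficientwise inequalities and the Euler operator\<close>

lemma fps_mult_nth_nonneg:
  "(\<And>n. 0 \<le> fps_nth p n) \<Longrightarrow> (\<And>n. 0 \<le> fps_nth q n) \<Longrightarrow> 0 \<le> fps_nth (p * q) (n::nat)"
  for p q :: "real fps"
  unfolding fps_mult_nth by (intro sum_nonneg mult_nonneg_nonneg) auto

lemma fps_power_nth_nonneg:
  "(\<And>n. 0 \<le> fps_nth p n) \<Longrightarrow> 0 \<le> fps_nth (p ^ k) (n::nat)" for p :: "real fps"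
  by (induction k arbitrary: n) (auto intro!: fps_mult_nth_nonneg)

lemma fps_mult_nth_mono:
  fixes p q :: "real fps"
  assumes "\<And>n. 0 \<le> fps_nth p n" "\<And>n. fps_nth p n \<le> fps_nth p' n"
    and "\<And>n. 0 \<le> fps_nth q n" "\<And>n. fps_nth q n \<le> fps_nth q' n"
  shows "fps_nth (p * q) n \<le> fps_nth (p' * q') n"
  unfolding fps_mult_nth using assms
  by (intro sum_mono mult_mono) (auto intro: order_trans)

lemma fps_power_nth_mono:
  fixes p :: "real fps"
  assumes "\<And>n. 0 \<le> fps_nth p n" "\<And>n. fps_nth p n \<le> fps_nth p' n"
  shows "fps_nth (p ^ k) n \<le> fps_nth (p' ^ k) n"
proof (induction k arbitrary: n)
  case (Suc k)
  show ?case unfolding power_Suc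
    using assms Suc by (intro fps_mult_nth_mono) (auto intro: fps_power_nth_nonneg)
qed simp

lemma nth_X_times_deriv [simp]: "fps_nth (fps_X * fps_deriv p) n = of_nat n * fps_nth (p::real fps) n"
  by (cases n) simp_all

text \<open>\<open>X d/dX\<close> multiplies the coefficient of index \<open>n\<close> by
  \<open>n\<close>, and \<open>X (u^(m+1))' = (m+1) u^m (X u')\<close>. For
  \<open>\<kappa> > 0\<close> the resulting factor changes sign at
  \<open>n = \<kappa> (m + 1)\<close>, which is how the saddle point is felt.\<close>

lemma euler_operator_power_nth:
  fixes u :: "real fps"
  assumes "\<kappa> \<noteq> 0"
  shows "fps_nth ((u - fps_const (1 / \<kappa>) * (fps_X * fps_deriv u)) * u ^ m) n
           = (1 - n / (\<kappa> * (m + 1))) * fps_nth (u ^ Suc m) n"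
proof -
  have "fps_deriv (u ^ Suc m) = of_nat (Suc m) * (fps_deriv u * u ^ m)"
    by (subst fps_deriv_power) (simp add: fps_of_nat mult.assoc del: of_nat_Suc)
  hence "(fps_X * fps_deriv u) * u ^ m = fps_const (1 / (m + 1)) * (fps_X * fps_deriv (u ^ Suc m))"
    by (simp add: fps_of_nat[symmetric] algebra_simps flip: fps_const_mult del: of_nat_Suc)
  moreover have "(u - fps_const (1 / \<kappa>) * (fps_X * fps_deriv u)) * u ^ m
          = u ^ Suc m - fps_const (1 / \<kappa>) * ((fps_X * fps_deriv u) * u ^ m)"
    by (simp add: left_diff_distrib mult.assoc)
  ultimately have "(u - fps_const (1 / \<kappa>) * (fps_X * fps_deriv u)) * u ^ m
          = u ^ Suc m - fps_const (1 / \<kappa>) * (fps_const (1 / (m + 1)) * (fps_X * fps_deriv (u ^ Suc m)))"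
    by (simp only:)
  thus ?thesis using assms
    by (simp only: fps_sub_nth fps_mult_left_const_nth nth_X_times_deriv) (simp add: field_simps)
qed

subsection \<open>Renewal sequences\<close>

lemma geometric_tail_sum:
  assumes "0 < q" "q < (1::real)" "finite I" "\<And>j. j \<in> I \<Longrightarrow> J \<le> j"
  shows "(\<Sum>j\<in>I. q ^ j) \<le> q ^ J / (1 - q)"
proof -
  have g: "(\<lambda>j. q ^ J * q ^ j) sums (q ^ J * (1 / (1 - q)))"
    using assms by (intro sums_mult geometric_sums) auto
  have inj: "inj_on (\<lambda>j. j - J) I" using assms(4) by (intro inj_onI) (metis eq_diff_iff)
  have "(\<Sum>j\<in>I. q ^ j) = (\<Sum>j\<in>I. q ^ J * q ^ (j - J))"
    using assms(4) by (intro sum.cong) (auto simp flip: power_add)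
  also have "\<dots> = (\<Sum>j\<in>(\<lambda>j. j - J) ` I. q ^ J * q ^ j)"
    using inj by (simp add: sum.reindex)
  also have "\<dots> \<le> (\<Sum>j. q ^ J * q ^ j)"
    using assms g by (intro sum_le_suminf) (auto simp: sums_iff)
  also have "\<dots> = q ^ J / (1 - q)" using g by (simp add: sums_iff)
  finally show ?thesis .
qed

text \<open>The renewal equation, read off from \<open>d = 1 + d a\<close>; the vanishing of
  \<open>a\<close> at 0 removes the term \<open>i = n\<close>.\<close>

lemma inverse_one_minus_nth:
  fixes a :: "real fps"
  assumes "fps_nth a 0 = 0" and "n > 0"
  shows "fps_nth (inverse (1 - a)) n = (\<Sum>i<n. fps_nth (inverse (1 - a)) i * fps_nth a (n - i))"
proof -
  let ?d = "inverse (1 - a)"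
  have "?d * (1 - a) = 1" using assms by (intro inverse_mult_eq_1) simp
  hence "?d = 1 + ?d * a" by (simp add: algebra_simps)
  hence "fps_nth ?d n = fps_nth (1 + ?d * a) n" by simp
  also have "\<dots> = (\<Sum>i\<le>n. fps_nth ?d i * fps_nth a (n - i))"
    using assms by (simp add: fps_mult_nth atLeast0AtMost)
  also have "{..n} = insert n {..<n}" by auto
  finally show ?thesis using assms by simp
qed

text \<open>If \<open>a\<close> is read as the law of a positive step, the coefficient of index
  \<open>n\<close> is the probability that \<open>n\<close> is a renewal time. Strong induction
  through the renewal equation works because the weights sum to at most 1.\<close>

lemma
  fixes a :: "real fps"
  assumes a: "fps_nth a 0 = 0" "\<And>i. 0 \<le> fps_nth a i" "(\<lambda>i. fps_nth a i) sums 1"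
  shows renewal_nonneg: "0 \<le> fps_nth (inverse (1 - a)) n"
    and renewal_le_1: "fps_nth (inverse (1 - a)) n \<le> 1"
proof -
  let ?d = "inverse (1 - a)"
  have "0 \<le> fps_nth ?d n \<and> fps_nth ?d n \<le> 1"
  proof (induction n rule: less_induct)
    case (less n)
    show ?case
    proof (cases "n = 0")
      case False
      have eq: "fps_nth ?d n = (\<Sum>i<n. fps_nth ?d i * fps_nth a (n - i))"
        using inverse_one_minus_nth[of a n] a False by auto
      have "fps_nth ?d n \<le> (\<Sum>i<n. 1 * fps_nth a (n - i))"
        unfolding eq using less a by (intro sum_mono mult_right_mono) auto
      also have "\<dots> = (\<Sum>i\<in>{1..n}. fps_nth a i)"
        by (simp, rule sum.reindex_bij_witness[of _ "\<lambda>i. n - i" "\<lambda>i. n - i"]) auto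
      also have "\<dots> \<le> (\<Sum>i. fps_nth a i)"
        using a by (intro sum_le_suminf) (auto simp: sums_iff)
      also have "\<dots> = 1" using a by (simp add: sums_iff)
      finally show ?thesis using eq less a by (auto intro!: sum_nonneg)
    qed (use a in simp)
  qed
  thus "0 \<le> fps_nth ?d n" "fps_nth ?d n \<le> 1" by auto
qed

text \<open>\<open>a\<close> may live on a lattice, so single values of the renewal sequence may
  vanish. Window sums stay bounded below all the same, because a step longer than \<open>J\<close>
  is improbable; \<open>a\<close> enters only through \<open>C\<close> and \<open>q\<close>.\<close>

lemma renewal_window:
  fixes a :: "real fps"
  assumes a: "fps_nth a 0 = 0" "\<And>i. 0 \<le> fps_nth a i" "(\<lambda>i. fps_nth a i) sums 1"
    and q: "0 < q" "q < 1" and C: "\<And>i. fps_nth a i \<le> C * q ^ i"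
    and J: "C * q ^ (J + 2) / (1 - q)\<^sup>2 \<le> 1 / 2"
    and n: "n \<ge> J"
  shows "1 / 2 \<le> (\<Sum>j\<le>J. fps_nth (inverse (1 - a)) (n - j))"
proof -
  let ?d = "inverse (1 - a)"
  define G :: "real fps" where "G = Abs_fps (\<lambda>_. 1)"
  \<comment> \<open>\<open>T j\<close> is the probability of a step longer than \<open>j\<close>; decomposing by the last renewal up to
    \<open>n\<close> gives \<open>\<Sum>\<^sub>j T j d(n - j) = 1\<close>.\<close>
  define T where "T = (\<lambda>j. 1 - (\<Sum>i\<le>j. fps_nth a i))"
  have C0: "0 \<le> C" using a(2)[of 0] C[of 0] by simp
  have TG: "fps_nth ((1 - a) * G) j = T j" for j
  proof -
    have "fps_nth ((1 - a) * G) j = (\<Sum>i\<le>j. fps_nth (1 - a) i)"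
      by (simp add: fps_mult_nth G_def atLeast0AtMost)
    thus ?thesis unfolding T_def by (simp add: sum_subtractf)
  qed
  have "(1 - a) * G * ?d = G * (?d * (1 - a))" by (simp only: mult_ac)
  also have "?d * (1 - a) = 1" using a by (intro inverse_mult_eq_1) simp
  finally have "(1 - a) * G * ?d = G" by simp
  hence "fps_nth ((1 - a) * G * ?d) n = 1" by (simp only:) (simp add: G_def)
  hence one: "(\<Sum>j\<le>n. T j * fps_nth ?d (n - j)) = 1"
    by (simp add: fps_mult_nth[of "(1 - a) * G"] TG atLeast0AtMost)
  have T1: "T j \<le> 1" for j unfolding T_def using a by (simp add: sum_nonneg)
  have Tq: "T j \<le> C / (1 - q) * q ^ (j + 1)" for j
  proof -
    have s: "summable (\<lambda>i. fps_nth a i)" using a by (simp add: sums_iff)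
    have g: "(\<lambda>i. C * q ^ (j + 1) * q ^ i) sums (C * q ^ (j + 1) * (1 / (1 - q)))"
      using q by (intro sums_mult geometric_sums) auto
    have "T j = (\<Sum>i. fps_nth a (i + Suc j))"
      unfolding T_def lessThan_Suc_atMost[symmetric]
      using suminf_split_initial_segment[OF s, of "Suc j"] a by (simp add: sums_iff)
    also have "\<dots> \<le> (\<Sum>i. C * q ^ (j + 1) * q ^ i)"
    proof (rule suminf_le)
      fix i show "fps_nth a (i + Suc j) \<le> C * q ^ (j + 1) * q ^ i"
        using C[of "i + Suc j"] by (simp add: power_add mult_ac)
      show "summable (\<lambda>i. fps_nth a (i + Suc j))" using s by (subst summable_iff_shift)
      show "summable (\<lambda>i. C * q ^ (j + 1) * q ^ i)" using g by (simp add: sums_iff)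
    qed
    also have "\<dots> = C * q ^ (j + 1) * (1 / (1 - q))" using g by (simp add: sums_iff)
    finally show ?thesis by simp
  qed
  \<comment> \<open>Beyond \<open>J\<close> the geometric bound on \<open>T\<close> is summed
    against \<open>d \<le> 1\<close>; the hypothesis on \<open>J\<close> says that this costs at
    most one half.\<close>
  have "(\<Sum>j\<in>{J<..n}. T j * fps_nth ?d (n - j)) \<le> (\<Sum>j\<in>{J<..n}. C / (1 - q) * q ^ (j + 1) * 1)"
    using renewal_nonneg[OF a] renewal_le_1[OF a] Tq C0 q by (intro sum_mono mult_mono) auto
  also have "\<dots> = C / (1 - q) * q * (\<Sum>j\<in>{J<..n}. q ^ j)" by (simp add: sum_distrib_left sum_divide_distrib mult_ac)
  also have "\<dots> \<le> C / (1 - q) * q * (q ^ (J + 1) / (1 - q))"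
    using C0 q by (intro mult_left_mono geometric_tail_sum) auto
  also have "\<dots> = C * q ^ (J + 2) / (1 - q)\<^sup>2" by (simp add: power2_eq_square)
  also note J
  finally have tail: "(\<Sum>j\<in>{J<..n}. T j * fps_nth ?d (n - j)) \<le> 1 / 2" .
  have "{..n} = {..J} \<union> {J<..n}" using n by auto
  hence "(\<Sum>j\<le>n. T j * fps_nth ?d (n - j))
      = (\<Sum>j\<le>J. T j * fps_nth ?d (n - j)) + (\<Sum>j\<in>{J<..n}. T j * fps_nth ?d (n - j))"
    by (simp only:) (rule sum.union_disjoint; auto)
  with one tail have "1 / 2 \<le> (\<Sum>j\<le>J. T j * fps_nth ?d (n - j))" by simp
  also have "\<dots> \<le> (\<Sum>j\<le>J. 1 * fps_nth ?d (n - j))"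
    using renewal_nonneg[OF a] T1 by (intro sum_mono mult_right_mono) auto
  finally show ?thesis by simp
qed

text \<open>Convolution of \<open>\<phi>/(1 - a)\<close> with \<open>(1 - a) u^m\<close>. The second
  factor is nonnegative up to index \<open>\<kappa> (m + 1)\<close> and, near that index, small
  compared with its absolute mass; so the finitely many quotient coefficients of unknown sign are
  outweighed once \<open>m\<close> is large.\<close>

lemma coeff_pos_of_quotient:
  fixes u \<phi> :: "real fps" and \<kappa> C \<eta> :: real and n0 s k m :: nat
  defines "a \<equiv> 1 - (u - fps_const (1 / \<kappa>) * (fps_X * fps_deriv u))"
  assumes u: "\<And>i. 0 \<le> fps_nth u i" "fps_nth u 0 = 1" "l1 u"
    and a: "\<And>i. 0 \<le> fps_nth a i" "(\<lambda>i. fps_nth a i) sums 1"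
    and \<kappa>: "\<kappa> > 0"
    and \<psi>: "\<And>i. \<bar>fps_nth (\<phi> * inverse (1 - a)) i\<bar> \<le> C"
      "\<And>i. i \<ge> n0 \<Longrightarrow> \<eta> \<le> fps_nth (\<phi> * inverse (1 - a)) i"
    and s: "s \<le> n0" "\<bar>k - \<kappa> * (m + 1)\<bar> \<le> s" and \<eta>: "\<eta> > 0"
    and m: "(C + \<eta>) * (n0 * (n0 + s)) * l1_norm u < \<eta> * (\<kappa> * (m + 1))"
  shows "0 < fps_nth (\<phi> * u ^ m) k"
proof -
  define d where "d = inverse (1 - a)"
  define \<psi> where "\<psi> = \<phi> * d"
  define e where "e = (1 - a) * u ^ m"
  have a0: "fps_nth a 0 = 0" unfolding a_def using u by simp
  have d1a: "d * (1 - a) = 1" unfolding d_def using a0 by (intro inverse_mult_eq_1) simp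
  have d: "0 \<le> fps_nth d i" "fps_nth d i \<le> 1" for i
    unfolding d_def using renewal_nonneg[OF a0 a] renewal_le_1[OF a0 a] by auto
  have e: "fps_nth e n = (1 - n / (\<kappa> * (m + 1))) * fps_nth (u ^ Suc m) n" for n
    unfolding e_def a_def using euler_operator_power_nth[of \<kappa> u m n] \<kappa> by simp
  have b0: "0 \<le> fps_nth (u ^ Suc m) n" for n using u by (intro fps_power_nth_nonneg) auto
  have "\<psi> * e = \<phi> * u ^ m * (d * (1 - a))" unfolding \<psi>_def e_def by (simp only: mult_ac)
  hence eq: "\<phi> * u ^ m = \<psi> * e" by (simp only: d1a mult_1_right)
  \<comment> \<open>Writing \<open>u^(m+1)\<close> through \<open>e\<close> bounds its coefficients
    by the mass of \<open>e\<close>, so no separate asymptotics of \<open>u^m\<close> are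
    needed.\<close>
  have "u * d * e = u ^ Suc m * (d * (1 - a))" unfolding e_def by (simp only: mult_ac power_Suc)
  hence eq2: "u ^ Suc m = u * d * e" by (simp only: d1a mult_1_right)
  \<comment> \<open>The absolute mass of \<open>e\<close> up to index \<open>k\<close>, the common
    yardstick for gain and loss.\<close>
  define M where "M = (\<Sum>i\<le>k. \<bar>fps_nth e (k - i)\<bar>)"
  have M': "M = (\<Sum>i\<le>k. \<bar>fps_nth e i\<bar>)"
    unfolding M_def by (rule sum.reindex_bij_witness[of _ "\<lambda>i. k - i" "\<lambda>i. k - i"]) auto
  have "1 = \<bar>fps_nth e 0\<bar>" using u by (simp add: e fps_power_zeroth)
  also have "\<dots> \<le> M" unfolding M' by (rule member_le_sum) auto
  finally have M1: "1 \<le> M" .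
  have bM: "fps_nth (u ^ Suc m) n \<le> l1_norm u * M" if "n \<le> k" for n
  proof -
    have "fps_nth (u ^ Suc m) n \<le> \<bar>fps_nth (e * (u * d)) n\<bar>" unfolding eq2 by (simp add: mult_ac)
    also have "\<dots> \<le> (\<Sum>i\<le>n. \<bar>fps_nth e i\<bar> * \<bar>fps_nth (u * d) (n - i)\<bar>)"
      by (rule abs_fps_mult_nth_le)
    also have "\<dots> \<le> (\<Sum>i\<le>n. \<bar>fps_nth e i\<bar> * l1_norm u)"
      using d by (intro sum_mono mult_left_mono abs_mult_nth_le_l1_norm u) auto
    also have "\<dots> \<le> (\<Sum>i\<le>k. \<bar>fps_nth e i\<bar> * l1_norm u)"
      using that l1_norm_nonneg[OF u(3)] by (intro sum_mono2) auto
    also have "\<dots> = l1_norm u * M" unfolding M' by (simp add: sum_distrib_left mult_ac)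
    finally show ?thesis .
  qed
  \<comment> \<open>For \<open>i < n0\<close> the index \<open>k - i\<close> lies within
    \<open>n0 + s\<close> of \<open>\<kappa> (m + 1)\<close>, which bounds the Euler factor; the
    remaining factor bounds \<open>u^(m+1)\<close>.\<close>
  let ?\<delta> = "(n0 + s) / (\<kappa> * (m + 1)) * (l1_norm u * M)"
  have \<delta>0: "0 \<le> ?\<delta>" using \<kappa> M1 l1_norm_nonneg[OF u(3)] by auto
  have C0: "0 \<le> C" using \<psi>(1)[of 0] by linarith
  have near: "\<bar>fps_nth e (k - i)\<bar> \<le> ?\<delta>" if "i < n0" "i \<le> k" for i
  proof -
    have "\<bar>1 - (k - i) / (\<kappa> * (m + 1))\<bar> = \<bar>\<kappa> * (m + 1) - (k - i)\<bar> / (\<kappa> * (m + 1))"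
    proof -
      have "\<bar>1 - y / c\<bar> = \<bar>c - y\<bar> / c" if c: "c > 0" for c y :: real
      proof -
        have "1 - y / c = (c - y) / c" using c by (simp add: diff_divide_distrib)
        thus ?thesis using c by (simp only: abs_divide abs_of_pos)
      qed
      thus ?thesis using \<kappa> by simp
    qed
    also have "\<dots> \<le> (n0 + s) / (\<kappa> * (m + 1))"
      using that s \<kappa> by (intro divide_right_mono) (auto simp: of_nat_diff)
    finally show ?thesis
      unfolding e abs_mult using b0[of "k - i"] bM[of "k - i"] that
      by (intro mult_mono) (auto simp: of_nat_diff)
  qed
  have step: "fps_nth \<psi> i * fps_nth e (k - i)
      \<ge> \<eta> * \<bar>fps_nth e (k - i)\<bar> - (if i < n0 then (C + \<eta>) * ?\<delta> else 0)" if "i \<le> k" for i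
  proof (cases "i < n0")
    case True
    have "\<bar>fps_nth \<psi> i * fps_nth e (k - i)\<bar> \<le> C * \<bar>fps_nth e (k - i)\<bar>"
      unfolding abs_mult using \<psi>(1)[of i] unfolding \<psi>_def d_def by (intro mult_right_mono) auto
    moreover have "(C + \<eta>) * \<bar>fps_nth e (k - i)\<bar> \<le> (C + \<eta>) * ?\<delta>"
      using near[OF True that] C0 \<eta> by (intro mult_left_mono) auto
    ultimately have "\<eta> * \<bar>fps_nth e (k - i)\<bar> - (C + \<eta>) * ?\<delta> \<le> fps_nth \<psi> i * fps_nth e (k - i)"
      by (simp add: distrib_right abs_le_iff)
    thus ?thesis using True by simp
  next
    case False
    \<comment> \<open>From \<open>i \<ge> n0 \<ge> s\<close>: the index has fallen back below the
      sign change of the Euler factor.\<close>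
    hence "k - i \<le> \<kappa> * (m + 1)" using s that by (simp add: of_nat_diff)
    hence "0 \<le> fps_nth e (k - i)"
      unfolding e using b0 \<kappa> that by (intro mult_nonneg_nonneg) (auto simp: of_nat_diff)
    moreover have "\<eta> * fps_nth e (k - i) \<le> fps_nth \<psi> i * fps_nth e (k - i)"
      using \<psi>(2)[of i] False calculation unfolding \<psi>_def d_def by (intro mult_right_mono) auto
    ultimately show ?thesis using False by simp
  qed
  have "0 < M * (\<eta> - (C + \<eta>) * (n0 * (n0 + s)) * l1_norm u / (\<kappa> * (m + 1)))"
  proof -
    have "(C + \<eta>) * (n0 * (n0 + s)) * l1_norm u / (\<kappa> * (m + 1)) < \<eta>"
      using m \<kappa> by (subst pos_divide_less_eq) auto
    thus ?thesis using M1 by (intro mult_pos_pos) auto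
  qed
  also have "\<dots> = \<eta> * M - n0 * ((C + \<eta>) * ?\<delta>)" by (simp add: algebra_simps)
  also have "\<dots> \<le> \<eta> * M - card {i\<in>{..k}. i < n0} * ((C + \<eta>) * ?\<delta>)"
  proof -
    have "card {i\<in>{..k}. i < n0} \<le> card {..<n0}" by (intro card_mono) auto
    hence "real (card {i\<in>{..k}. i < n0}) \<le> real n0" by simp
    moreover have "0 \<le> (C + \<eta>) * ?\<delta>" using mult_nonneg_nonneg[OF _ \<delta>0, of "C + \<eta>"] C0 \<eta> by simp
    ultimately show ?thesis by (intro diff_left_mono mult_right_mono)
  qed
  also have "\<dots> = (\<Sum>i\<le>k. \<eta> * \<bar>fps_nth e (k - i)\<bar> - (if i < n0 then (C + \<eta>) * ?\<delta> else 0))"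
    unfolding M_def sum_subtractf by (subst sum.inter_filter[symmetric]) (auto simp: sum_distrib_left)
  also have "\<dots> \<le> (\<Sum>i\<le>k. fps_nth \<psi> i * fps_nth e (k - i))"
    by (intro sum_mono step) auto
  also have "\<dots> = fps_nth (\<phi> * u ^ m) k"
    unfolding eq by (simp add: fps_mult_nth atLeast0AtMost)
  finally show ?thesis .
qed

subsection \<open>Smoothing by convolution powers\<close>

text \<open>The variance of a symmetric binomial law, up to scaling: \<open>(N - 2 i)^2\<close> is
  expanded in \<open>1\<close>, \<open>i\<close> and \<open>i (i - 1)\<close>, whose Bernstein means
  at 1/2 are known.\<close>

lemma sum_binomial_variance:
  "(\<Sum>i\<le>N. real (N choose i) * (real N - 2 * real i)\<^sup>2) = real N * 2 ^ N"
proof -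
  have B: "real (N choose i) = 2 ^ N * Bernstein N i (1 / 2)" if "i \<le> N" for i
    using that by (simp add: Bernstein_def power_one_over flip: power_add)
  have "(\<Sum>i\<le>N. real (N choose i) * (real N - 2 * real i)\<^sup>2)
      = (\<Sum>i\<le>N. 2 ^ N * ((real N)\<^sup>2 * Bernstein N i (1 / 2)
          + (4 - 4 * real N) * (real i * Bernstein N i (1 / 2))
          + 4 * (real i * (real i - 1) * Bernstein N i (1 / 2))))"
    by (intro sum.cong) (simp_all add: B power2_eq_square algebra_simps)
  also have "\<dots> = 2 ^ N * ((real N)\<^sup>2 * 1 + (4 - 4 * real N) * (real N * (1 / 2))
          + 4 * (real N * (real N - 1) * (1 / 2)\<^sup>2))"
    by (simp only: sum_distrib_left[symmetric] sum.distrib sum_Bernstein sum_k_Bernstein sum_kk_Bernstein)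
  also have "\<dots> = real N * 2 ^ N" by (simp add: power2_eq_square algebra_simps)
  finally show ?thesis .
qed

lemma l1_finite_support:
  assumes "\<And>n. n > N \<Longrightarrow> fps_nth p n = 0"
  shows "l1 p" and "l1_norm p = (\<Sum>n\<le>N. \<bar>fps_nth p n\<bar>)"
proof -
  have "(\<lambda>n. \<bar>fps_nth p n\<bar>) sums (\<Sum>n\<le>N. \<bar>fps_nth p n\<bar>)"
    using assms by (intro sums_finite) auto
  thus "l1 p" "l1_norm p = (\<Sum>n\<le>N. \<bar>fps_nth p n\<bar>)"
    unfolding l1_def l1_norm_def by (auto simp: sums_iff)
qed

lemma one_plus_X_power_nth: "fps_nth ((1 + fps_X :: real fps) ^ n) i = real (n choose i)"
proof (induction n arbitrary: i)
  case (Suc n)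
  thus ?case by (cases i) (simp_all add: distrib_right)
next
  case 0
  show ?case by (cases i) simp_all
qed

text \<open>Takes the place of Cauchy-Schwarz: sums of \<open>\<bar>x\<bar>\<close> reduce to second
  moments, with \<open>\<alpha>\<close> free to be optimized.\<close>

lemma abs_le_AM_GM: "\<alpha> > 0 \<Longrightarrow> \<bar>x\<bar> \<le> (\<alpha> + x\<^sup>2 / \<alpha>) / (2::real)"
proof -
  assume "\<alpha> > 0"
  moreover have "0 \<le> (\<bar>x\<bar> - \<alpha>)\<^sup>2" by simp
  ultimately show ?thesis by (simp add: field_simps power2_eq_square)
qed

text \<open>The differences of neighbouring binomial coefficients are
  \<open>(n+1 choose i) (n + 1 - 2 i) / (n + 1)\<close>, so the norm is a first absolute moment,
  which the variance controls.\<close>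

lemma binomial_difference_norm:
  fixes n :: nat
  defines "p \<equiv> (1 - fps_X) * (1 + fps_X) ^ n"
  shows "l1 p" and "l1_norm p \<le> 2 ^ n * (2 / sqrt (n + 1))"
proof -
  have nth: "fps_nth p i = real (Suc n choose i) * (real (Suc n) - 2 * real i) / Suc n" for i
  proof (cases i)
    case 0
    thus ?thesis by (simp add: p_def left_diff_distrib one_plus_X_power_nth)
  next
    case (Suc j)
    have 1: "real (Suc n) * (n choose j) = Suc j * (Suc n choose Suc j)"
      by (metis Suc_times_binomial of_nat_mult)
    have 2: "real (Suc n choose Suc j) = (n choose j) + (n choose Suc j)" by simp
    have "fps_nth p i = real (n choose Suc j) - (n choose j)"
      by (simp add: p_def left_diff_distrib one_plus_X_power_nth Suc)
    also have "\<dots> = (Suc n choose Suc j) - 2 * real (n choose j)" unfolding 2 by simp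
    finally have eq: "fps_nth p i = (Suc n choose Suc j) - 2 * real (n choose j)" .
    have "real (Suc n) * fps_nth p i
        = real (Suc n) * (Suc n choose Suc j) - 2 * (real (Suc n) * (n choose j))"
      unfolding eq by (simp only: right_diff_distrib mult.left_commute)
    thus ?thesis unfolding 1 Suc by (simp add: field_simps del: binomial_Suc_Suc)
  qed
  have fin: "fps_nth p i = 0" if "i > Suc n" for i using that by (simp add: nth binomial_eq_0)
  show "l1 p" using l1_finite_support[of "Suc n" p] fin by blast
  \<comment> \<open>The scale of the standard deviation; it makes the two AM-GM terms contribute
    equally.\<close>
  define \<alpha> where "\<alpha> = sqrt (Suc n)"
  have \<alpha>: "\<alpha> > 0" "\<alpha> * \<alpha> = Suc n" unfolding \<alpha>_def by auto
  have "l1_norm p = (\<Sum>i\<le>Suc n. \<bar>fps_nth p i\<bar>)" using l1_finite_support[of "Suc n" p] fin by blast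
  also have "\<dots> \<le> (\<Sum>i\<le>Suc n. real (Suc n choose i) * ((\<alpha> + (real (Suc n) - 2 * real i)\<^sup>2 / \<alpha>) / 2) / Suc n)"
    unfolding nth abs_mult abs_divide abs_of_nat
    by (intro sum_mono divide_right_mono mult_left_mono abs_le_AM_GM \<alpha>) auto
  also have "\<dots> = ((\<Sum>i\<le>Suc n. real (Suc n choose i)) * \<alpha>
      + (\<Sum>i\<le>Suc n. real (Suc n choose i) * (real (Suc n) - 2 * real i)\<^sup>2) / \<alpha>) / (2 * real (Suc n))"
    by (simp only: sum_divide_distrib sum_distrib_right sum.distrib[symmetric])
       (intro sum.cong; simp add: field_simps del: of_nat_Suc binomial_Suc_Suc)
  also have "(\<Sum>i\<le>Suc n. real (Suc n choose i)) = 2 ^ Suc n"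
    using choose_row_sum[of "Suc n"] by (metis of_nat_numeral of_nat_power of_nat_sum)
  also have "(\<Sum>i\<le>Suc n. real (Suc n choose i) * (real (Suc n) - 2 * real i)\<^sup>2) = real (Suc n) * 2 ^ Suc n"
    by (rule sum_binomial_variance)
  also have "(2 ^ Suc n * \<alpha> + real (Suc n) * 2 ^ Suc n / \<alpha>) / (2 * real (Suc n)) = 2 ^ n * (2 / \<alpha>)"
    using \<alpha>(1) unfolding \<alpha>(2)[symmetric] by (simp add: field_simps)
  finally show "l1_norm p \<le> 2 ^ n * (2 / sqrt (n + 1))" by (simp add: \<alpha>_def add.commute)
qed

text \<open>The mean of \<open>1/(N + 1)\<close> for a binomial \<open>N\<close>. Absorbing
  \<open>n + 1\<close> into the binomial coefficient gives the expansion of order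
  \<open>K + 1\<close> without its term of index 0, whence the inequality.\<close>

lemma sum_binomial_div_Suc_le:
  fixes x y :: real
  assumes "0 < x" "0 \<le> y" "x + y = 1"
  shows "(\<Sum>n\<le>K. real (K choose n) * x ^ n * y ^ (K - n) / (real n + 1)) \<le> 1 / ((real K + 1) * x)"
proof -
  have "(\<Sum>n\<le>K. real (K choose n) * x ^ n * y ^ (K - n) / (real n + 1))
      = (\<Sum>n\<le>K. real (Suc K choose Suc n) * x ^ Suc n * y ^ (Suc K - Suc n)) / ((real K + 1) * x)"
  proof (subst sum_divide_distrib, rule sum.cong)
    fix n
    have "real (Suc K) * (K choose n) = Suc n * (Suc K choose Suc n)"
      by (metis Suc_times_binomial of_nat_mult)
    hence "real (K choose n) / (real n + 1) = (Suc K choose Suc n) / (real K + 1)"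
      by (simp add: field_simps del: binomial_Suc_Suc)
    hence "real (K choose n) / (real n + 1) * (x ^ n * y ^ (K - n))
        = (Suc K choose Suc n) / (real K + 1) * (x ^ n * y ^ (K - n))" by (simp only:)
    thus "real (K choose n) * x ^ n * y ^ (K - n) / (real n + 1)
        = real (Suc K choose Suc n) * x ^ Suc n * y ^ (Suc K - Suc n) / ((real K + 1) * x)"
      using assms by (simp del: binomial_Suc_Suc)
  qed simp
  also have "(\<Sum>n\<le>K. real (Suc K choose Suc n) * x ^ Suc n * y ^ (Suc K - Suc n))
      \<le> (\<Sum>n\<le>Suc K. real (Suc K choose n) * x ^ n * y ^ (Suc K - n))"
    unfolding sum.atMost_Suc_shift using assms by simp
  also have "\<dots> = 1" using binomial_ring[of x y "Suc K"] assms by simp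
  finally show ?thesis using assms by (simp add: divide_right_mono)
qed

lemma l1_one_minus_X_mult:
  assumes "l1 p" shows "l1 ((1 - fps_X) * p)"
  using l1_mult[OF l1_finite_support(1)[of 1 "1 - fps_X"] assms] by (simp add: fps_X_def)

text \<open>Mass at both 0 and 1 makes \<open>V^K\<close> nearly invariant under a unit shift, at a
  rate that depends on \<open>V\<close> only through \<open>b\<close>. Taking
  \<open>\<delta>\<close> small first and then \<open>K\<close> large makes the bound arbitrarily
  small.\<close>

lemma l1_norm_smoothing:
  fixes V :: "real fps"
  assumes V: "\<And>i. 0 \<le> fps_nth V i" "(\<lambda>i. fps_nth V i) sums 1"
    and b: "0 < b" "b \<le> fps_nth V 0" "b \<le> fps_nth V 1" and \<delta>: "\<delta> > 0"
  shows "l1_norm ((1 - fps_X) * V ^ K) \<le> \<delta> + 1 / (2 * \<delta> * b * (K + 1))"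
proof -
  \<comment> \<open>splitting off \<open>b (1 + X)\<close> reduces the claim to powers of \<open>1 + X\<close>\<close>
  define W where "W = V - fps_const b * (1 + fps_X)"
  have bX: "fps_nth (fps_const b * (1 + fps_X)) n = (if n = 0 then b else if n = 1 then b else 0)" for n
    by (simp add: fps_X_def)
  have W0: "0 \<le> fps_nth W n" for n unfolding W_def fps_sub_nth bX using b V by auto
  have "(\<lambda>n. fps_nth (fps_const b * (1 + fps_X)) n) sums (\<Sum>n\<le>1. fps_nth (fps_const b * (1 + fps_X)) n)"
    by (intro sums_finite) (auto simp: bX)
  from sums_diff[OF V(2) this] have "(\<lambda>n. fps_nth W n) sums (1 - 2 * b)"
    unfolding W_def by (simp add: bX)
  hence W: "l1 W" "l1_norm W = 1 - 2 * b"
    unfolding l1_def l1_norm_def using W0 by (auto simp: sums_iff)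
  hence b2: "0 \<le> 1 - 2 * b" using l1_norm_nonneg by metis
  define p where "p = (\<lambda>n::nat. (1 - fps_X) * (1 + fps_X) ^ n :: real fps)"
  \<comment> \<open>\<open>q n\<close> collects the products with \<open>n\<close> factors
    \<open>b (1 + X)\<close>. As \<open>W\<close> has mass \<open>1 - 2 b\<close>, their norms carry
    the weights of a binomial law with parameters \<open>K\<close> and \<open>2 b\<close>.\<close>
  define q where "q = (\<lambda>n. fps_const (real (K choose n) * b ^ n) * (p n * W ^ (K - n)))"
  have "V = fps_const b * (1 + fps_X) + W" unfolding W_def by simp
  hence "(1 - fps_X) * V ^ K
      = (1 - fps_X) * (\<Sum>n\<le>K. of_nat (K choose n) * (fps_const b * (1 + fps_X)) ^ n * W ^ (K - n))"
    by (simp only: binomial_ring)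
  also have "\<dots> = (\<Sum>n\<le>K. q n)"
    unfolding sum_distrib_left q_def p_def power_mult_distrib fps_const_power fps_const_mult[symmetric] fps_of_nat
    by (intro sum.cong refl) (simp only: mult_ac)
  finally have eq: "(1 - fps_X) * V ^ K = (\<Sum>n\<le>K. q n)" .
  have p: "l1 (p n)" "l1_norm (p n) \<le> 2 ^ n * (2 / sqrt (n + 1))" for n
    unfolding p_def by (fact binomial_difference_norm)+
  have ql: "l1 (q n)" for n unfolding q_def using p W by (intro l1_mult l1_power) auto
  have q: "l1_norm (q n) \<le> real (K choose n) * (2 * b) ^ n * (1 - 2 * b) ^ (K - n) * (2 / sqrt (real n + 1))" for n
  proof -
    have "l1_norm (q n) \<le> l1_norm (fps_const (real (K choose n) * b ^ n)) * l1_norm (p n * W ^ (K - n))"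
      unfolding q_def using p W by (intro l1_norm_mult_le l1_mult l1_power) auto
    also have "\<dots> \<le> (real (K choose n) * b ^ n) * (2 ^ n * (2 / sqrt (n + 1)) * (1 - 2 * b) ^ (K - n))"
    proof (rule mult_mono)
      have "l1_norm (p n * W ^ (K - n)) \<le> l1_norm (p n) * l1_norm (W ^ (K - n))"
        using p W by (intro l1_norm_mult_le l1_power) auto
      also have "\<dots> \<le> 2 ^ n * (2 / sqrt (n + 1)) * (1 - 2 * b) ^ (K - n)"
        using p(2)[of n] l1_norm_power_le[OF W(1), of "K - n"] W b2
        by (intro mult_mono) (auto intro!: l1_norm_nonneg l1_power)
      finally show "l1_norm (p n * W ^ (K - n)) \<le> 2 ^ n * (2 / sqrt (n + 1)) * (1 - 2 * b) ^ (K - n)" .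
    qed (use b p W in \<open>auto intro!: l1_norm_nonneg l1_mult l1_power\<close>)
    finally show ?thesis by (simp add: power_mult_distrib mult_ac add.commute)
  qed
  \<comment> \<open>Trades the square root for \<open>1/(n + 1)\<close>, whose binomial mean has
    just been bounded.\<close>
  have AMGM: "2 / sqrt (real n + 1) \<le> \<delta> + 1 / \<delta> * (1 / (real n + 1))" for n
    using abs_le_AM_GM[of \<delta> "1 / sqrt (real n + 1)"] \<delta> by (simp add: power_divide field_simps)
  have "l1_norm ((1 - fps_X) * V ^ K) \<le> (\<Sum>n\<le>K. l1_norm (q n))"
    unfolding eq using ql by (intro l1_norm_sum_le) auto
  also have "\<dots> \<le> (\<Sum>n\<le>K. real (K choose n) * (2 * b) ^ n * (1 - 2 * b) ^ (K - n) * (\<delta> + 1 / \<delta> * (1 / (real n + 1))))"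
  proof (intro sum_mono)
    fix n
    have "real (K choose n) * (2 * b) ^ n * (1 - 2 * b) ^ (K - n) * (2 / sqrt (real n + 1))
      \<le> real (K choose n) * (2 * b) ^ n * (1 - 2 * b) ^ (K - n) * (\<delta> + 1 / \<delta> * (1 / (real n + 1)))"
      using b b2 by (intro mult_left_mono AMGM mult_nonneg_nonneg zero_le_power) auto
    from order_trans[OF q this] show "l1_norm (q n) \<le> real (K choose n) * (2 * b) ^ n * (1 - 2 * b) ^ (K - n) * (\<delta> + 1 / \<delta> * (1 / (real n + 1)))" .
  qed
  also have "\<dots> = \<delta> * (\<Sum>n\<le>K. real (K choose n) * (2 * b) ^ n * (1 - 2 * b) ^ (K - n))
      + 1 / \<delta> * (\<Sum>n\<le>K. real (K choose n) * (2 * b) ^ n * (1 - 2 * b) ^ (K - n) / (real n + 1))"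
  proof -
    have "B * (\<delta> + 1 / \<delta> * (1 / y)) = \<delta> * B + 1 / \<delta> * (B / y)" for B y :: real
      by (simp add: distrib_left mult.commute)
    thus ?thesis by (simp only: sum_distrib_left sum.distrib[symmetric])
  qed
  also have "(\<Sum>n\<le>K. real (K choose n) * (2 * b) ^ n * (1 - 2 * b) ^ (K - n)) = 1"
    using binomial_ring[of "2 * b" "1 - 2 * b" K] by simp
  also have "\<delta> * 1 + 1 / \<delta> * (\<Sum>n\<le>K. real (K choose n) * (2 * b) ^ n * (1 - 2 * b) ^ (K - n) / (real n + 1))
      \<le> \<delta> * 1 + 1 / \<delta> * (1 / ((real K + 1) * (2 * b)))"
    using b b2 \<delta> by (intro add_left_mono mult_left_mono sum_binomial_div_Suc_le) auto
  finally show ?thesis by (simp add: mult_ac add.commute)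
qed

text \<open>\<open>V^J\<close> dominates \<open>b^J (1 + X)^J\<close>, whose coefficients at
  \<open>0, ..., J\<close> are at least \<open>b^J\<close>. Convolution thus sees the whole window,
  and a bound on window sums becomes a bound at each index: periodicity is removed.\<close>

lemma window_conv_lower:
  fixes V d :: "real fps"
  assumes V: "\<And>i. 0 \<le> fps_nth V i" and b: "0 < b" "b \<le> fps_nth V 0" "b \<le> fps_nth V 1"
    and d: "\<And>i. 0 \<le> fps_nth d i" and w: "w \<le> (\<Sum>j\<le>J. fps_nth d (n - j))" and n: "J \<le> n"
  shows "b ^ J * w \<le> fps_nth (V ^ J * d) n"
proof -
  have bX: "fps_nth (fps_const b * (1 + fps_X)) i = (if i = 0 then b else if i = 1 then b else 0)" for i
    by (simp add: fps_X_def)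
  have "fps_nth ((fps_const b * (1 + fps_X)) ^ J) j \<le> fps_nth (V ^ J) j" for j
    using V b unfolding bX[symmetric] by (intro fps_power_nth_mono) (auto simp: bX simp del: One_nat_def)
  hence Vj: "b ^ J * (J choose j) \<le> fps_nth (V ^ J) j" for j
    by (simp add: power_mult_distrib fps_const_power one_plus_X_power_nth)
  have "b ^ J * w \<le> b ^ J * (\<Sum>j\<le>J. fps_nth d (n - j))" using w b by simp
  also have "\<dots> = (\<Sum>j\<le>J. b ^ J * 1 * fps_nth d (n - j))" by (simp add: sum_distrib_left)
  also have "\<dots> \<le> (\<Sum>j\<le>J. fps_nth (V ^ J) j * fps_nth d (n - j))"
  proof (intro sum_mono mult_right_mono d)
    fix j assume "j \<in> {..J}"
    hence "1 \<le> real (J choose j)" by (simp add: Suc_leI)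
    hence "b ^ J * 1 \<le> b ^ J * (J choose j)" using b by (intro mult_left_mono) auto
    with Vj[of j] show "b ^ J * 1 \<le> fps_nth (V ^ J) j" by linarith
  qed
  also have "\<dots> \<le> (\<Sum>j\<le>n. fps_nth (V ^ J) j * fps_nth d (n - j))"
    using n V d by (intro sum_mono2) (auto intro!: mult_nonneg_nonneg fps_power_nth_nonneg)
  also have "\<dots> = fps_nth (V ^ J * d) n" by (simp add: fps_mult_nth atLeast0AtMost)
  finally show ?thesis .
qed

lemma nonneg_sums_imp_l1:
  assumes "\<And>i. 0 \<le> fps_nth V i" "(\<lambda>i. fps_nth V i) sums x"
  shows "l1 V" "l1_norm V = x"
  using assms unfolding l1_def l1_norm_def by (auto simp: sums_iff)

text \<open>Markov's inequality: \<open>V^K\<close> is the law of a sum of \<open>K\<close>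
  independent steps and has mean at most \<open>K \<mu>\<close>.\<close>

lemma sum_power_tail_le:
  fixes V :: "real fps"
  assumes V: "\<And>i. 0 \<le> fps_nth V i" "(\<lambda>i. fps_nth V i) sums 1"
    and \<mu>: "l1 (fps_X * fps_deriv V)" "l1_norm (fps_X * fps_deriv V) \<le> \<mu>" and n: "finite I" "\<And>i. i \<in> I \<Longrightarrow> n \<le> i"
  shows "n * (\<Sum>i\<in>I. fps_nth (V ^ K) i) \<le> K * \<mu>"
proof -
  note l = nonneg_sums_imp_l1[OF V]
  have "fps_X * fps_deriv (V ^ K) = of_nat K * (V ^ (K - 1) * (fps_X * fps_deriv V))"
    by (simp add: fps_deriv_power fps_of_nat mult_ac)
  hence eq: "fps_X * fps_deriv (V ^ K) = fps_const (real K) * (V ^ (K - 1) * (fps_X * fps_deriv V))"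
    by (simp add: fps_of_nat)
  have L: "l1 (V ^ (K - 1) * (fps_X * fps_deriv V))" by (intro l1_mult[OF l1_power[OF l(1)] \<mu>(1)])
  have L': "l1 (fps_X * fps_deriv (V ^ K))" unfolding eq by (rule l1_mult[OF l1_const L])
  have "l1_norm (V ^ (K - 1) * (fps_X * fps_deriv V)) \<le> l1_norm (V ^ (K - 1)) * l1_norm (fps_X * fps_deriv V)"
    by (intro l1_norm_mult_le[OF l1_power[OF l(1)] \<mu>(1)])
  also have "\<dots> \<le> 1 * \<mu>"
    using l1_norm_power_le[OF l(1), of "K - 1"] l(2) \<mu>
    by (intro mult_mono) (auto intro: l1_norm_nonneg)
  finally have 1: "l1_norm (V ^ (K - 1) * (fps_X * fps_deriv V)) \<le> \<mu>" by simp
  have "n * (\<Sum>i\<in>I. fps_nth (V ^ K) i) \<le> (\<Sum>i\<in>I. \<bar>fps_nth (fps_X * fps_deriv (V ^ K)) i\<bar>)"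
    unfolding sum_distrib_left nth_X_times_deriv abs_mult
    using n V by (intro sum_mono mult_mono) (auto intro: fps_power_nth_nonneg)
  also have "\<dots> \<le> l1_norm (fps_X * fps_deriv (V ^ K))" using L' n by (intro sum_le_l1_norm)
  also have "\<dots> \<le> real K * l1_norm (V ^ (K - 1) * (fps_X * fps_deriv V))"
    unfolding eq using l1_norm_mult_le[OF l1_const[of "real K"] L] by simp
  also have "\<dots> \<le> K * \<mu>" using 1 by (intro mult_left_mono) auto
  finally show ?thesis .
qed

text \<open>Split \<open>V^K d\<close> into \<open>V^(K-J)\<close> and \<open>V^J d\<close>. The
  second factor is at least \<open>b^J / 2\<close> from index \<open>J\<close> on, and by Markov's
  inequality the first has at least half of its mass at indices up to \<open>n - J\<close>.\<close>

lemma power_renewal_lower: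
  fixes V d :: "real fps" and \<mu> :: real and n J K :: nat
  assumes V: "\<And>i. 0 \<le> fps_nth V i" "(\<lambda>i. fps_nth V i) sums 1"
    and b: "0 < b" "b \<le> fps_nth V 0" "b \<le> fps_nth V 1"
    and \<mu>: "l1 (fps_X * fps_deriv V)" "l1_norm (fps_X * fps_deriv V) \<le> \<mu>"
    and d: "\<And>i. 0 \<le> fps_nth d i" and J: "\<And>n. J \<le> n \<Longrightarrow> 1 / 2 \<le> (\<Sum>j\<le>J. fps_nth d (n - j))"
    and K: "J \<le> K" and n: "2 * (K * \<mu>) \<le> n - J" "J < n"
  shows "b ^ J / 4 \<le> fps_nth (V ^ K * d) n"
proof -
  note l = nonneg_sums_imp_l1[OF V]
  let ?P = "V ^ (K - J)"
  have P0: "0 \<le> fps_nth ?P i" for i using V by (intro fps_power_nth_nonneg)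
  have P1: "(\<lambda>i. fps_nth (V ^ N) i) sums 1" for N
  proof (induction N)
    case 0
    show ?case using sums_finite[of "{0}" "\<lambda>i. fps_nth (1::real fps) i"] by simp
  next
    case (Suc N)
    have "(\<lambda>k. \<Sum>i\<le>k. fps_nth V i * fps_nth (V ^ N) (k - i)) sums (1 * 1)"
      using Cauchy_product_sums[of "fps_nth V" "fps_nth (V ^ N)"] l(1) l1_power[OF l(1), of N] Suc V(2)
      unfolding l1_def by (simp add: sums_iff)
    thus ?case by (simp add: fps_mult_nth atLeast0AtMost)
  qed
  have tail: "1 / 2 \<le> (\<Sum>i\<le>n - J. fps_nth ?P i)"
  proof -
    have s: "summable (\<lambda>i. fps_nth ?P i)" "(\<Sum>i. fps_nth ?P i) = 1"
      using P1[of "K - J"] by (auto simp: sums_iff)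
    have "(\<Sum>i. fps_nth ?P i) \<le> (\<Sum>i\<le>n - J. fps_nth ?P i) + 1 / 2"
    proof (rule suminf_le_const[OF s(1)])
      fix N
      have "(n - J) * (\<Sum>i\<in>{n - J<..<N}. fps_nth ?P i) \<le> real (K - J) * \<mu>"
        by (rule sum_power_tail_le[OF V \<mu>]) auto
      also have "\<dots> \<le> K * \<mu>"
        using \<mu> l1_norm_nonneg[OF \<mu>(1)] K by (intro mult_right_mono) auto
      also have "\<dots> \<le> (n - J) * (1 / 2)" using n by simp
      finally have *: "(\<Sum>i\<in>{n - J<..<N}. fps_nth ?P i) \<le> 1 / 2"
        using n by (subst (asm) mult_le_cancel_left_pos) auto
      have "(\<Sum>i<N. fps_nth ?P i) \<le> (\<Sum>i\<in>{..n - J} \<union> {n - J<..<N}. fps_nth ?P i)"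
        using P0 by (intro sum_mono2) auto
      also have "\<dots> = (\<Sum>i\<le>n - J. fps_nth ?P i) + (\<Sum>i\<in>{n - J<..<N}. fps_nth ?P i)"
        by (rule sum.union_disjoint) auto
      finally show "(\<Sum>i<N. fps_nth ?P i) \<le> (\<Sum>i\<le>n - J. fps_nth ?P i) + 1 / 2" using * by simp
    qed
    thus ?thesis using s by simp
  qed
  have Vd: "b ^ J * (1 / 2) \<le> fps_nth (V ^ J * d) i" if "i \<ge> J" for i
    using window_conv_lower[OF V(1) b d J] that by blast
  have Vd0: "0 \<le> fps_nth (V ^ J * d) i" for i
    using V d by (intro fps_mult_nth_nonneg fps_power_nth_nonneg)
  have "b ^ J / 4 \<le> (\<Sum>i\<le>n - J. fps_nth ?P i) * (b ^ J * (1 / 2))"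
    using mult_right_mono[OF tail, of "b ^ J * (1 / 2)"] b by simp
  also have "\<dots> \<le> (\<Sum>i\<le>n - J. fps_nth ?P i * fps_nth (V ^ J * d) (n - i))"
    unfolding sum_distrib_right using P0 n by (intro sum_mono mult_left_mono Vd) auto
  also have "\<dots> \<le> (\<Sum>i\<le>n. fps_nth ?P i * fps_nth (V ^ J * d) (n - i))"
    using P0 Vd0 by (intro sum_mono2) auto
  also have "\<dots> = fps_nth (?P * (V ^ J * d)) n" by (simp add: fps_mult_nth atLeast0AtMost)
  also have "?P * (V ^ J * d) = V ^ K * d"
    using K by (simp add: mult.assoc[symmetric] power_add[symmetric])
  finally show ?thesis .
qed

text \<open>\<open>S\<close> stands for the value of \<open>F\<close> at 1. It contributes at least
  \<open>f0 b^J / 4\<close>, while the multiple of \<open>1 - X\<close> is damped by smoothing to at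
  most half of that.\<close>

lemma quotient_lower:
  fixes V d F :: "real fps" and \<mu> \<delta> b CG S f0 :: real and n J K :: nat
  assumes V: "\<And>i. 0 \<le> fps_nth V i" "(\<lambda>i. fps_nth V i) sums 1"
    and b: "0 < b" "b \<le> fps_nth V 0" "b \<le> fps_nth V 1"
    and \<mu>: "l1 (fps_X * fps_deriv V)" "l1_norm (fps_X * fps_deriv V) \<le> \<mu>"
    and d: "\<And>i. 0 \<le> fps_nth d i" "\<And>i. fps_nth d i \<le> 1"
    and J: "\<And>n. J \<le> n \<Longrightarrow> 1 / 2 \<le> (\<Sum>j\<le>J. fps_nth d (n - j))"
    and F: "F = fps_const S + (1 - fps_X) * G" "l1 G" "l1_norm G \<le> CG" "f0 \<le> S" "0 < f0"
    and \<delta>: "\<delta> > 0" "CG * (\<delta> + 1 / (2 * \<delta> * b * (K + 1))) \<le> f0 * b ^ J / 8"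
    and K: "J \<le> K" and n: "2 * (K * \<mu>) \<le> n - J" "J < n"
  shows "f0 * b ^ J / 8 \<le> fps_nth (F * V ^ K * d) n"
proof -
  note l = nonneg_sums_imp_l1[OF V]
  let ?H = "(1 - fps_X) * V ^ K"
  have lH: "l1 ?H" using l by (intro l1_one_minus_X_mult l1_power)
  have "\<bar>fps_nth (G * ?H * d) n\<bar> \<le> l1_norm (G * ?H)"
    using d by (intro abs_mult_nth_le_l1_norm[OF l1_mult[OF F(2) lH]]) auto
  also have "\<dots> \<le> l1_norm G * l1_norm ?H" using F lH by (intro l1_norm_mult_le)
  also have "\<dots> \<le> CG * (\<delta> + 1 / (2 * \<delta> * b * (K + 1)))"
    using F l1_norm_nonneg[OF F(2)] l1_norm_nonneg[OF lH] l1_norm_smoothing[OF V b \<delta>(1)]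
    by (intro mult_mono) auto
  also note \<delta>(2)
  finally have err: "\<bar>fps_nth (G * ?H * d) n\<bar> \<le> f0 * b ^ J / 8" .
  have low: "b ^ J / 4 \<le> fps_nth (V ^ K * d) n"
    by (rule power_renewal_lower[OF V b \<mu> d(1) J K n])
  hence "f0 * (b ^ J / 4) \<le> S * fps_nth (V ^ K * d) n"
    using F b by (intro mult_mono) auto
  moreover have "F * V ^ K * d = fps_const S * (V ^ K * d) + G * ?H * d"
    unfolding F(1) by (simp add: algebra_simps)
  ultimately show ?thesis using err by (simp add: abs_le_iff)
qed

text \<open>The ratio is that of the binomial coefficients \<open>K choose n\<close>. In the
  convolution of \<open>V - X V'/\<kappa>\<close> with \<open>V^K\<close>, all coefficients of the
  first factor beyond index 0 are nonpositive, so it is enough to keep the terms of index 0 and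
  1.\<close>

lemma power_coeff_ratio:
  fixes V :: "real fps"
  assumes V: "\<And>i. 0 \<le> fps_nth V i" "fps_nth V 0 = 1" "1 \<le> fps_nth V 1"
    and n: "0 < n" "n \<le> K + 1"
  shows "(real K + 1 - n) * fps_nth (V ^ K) (n - 1) \<le> n * fps_nth (V ^ K) n"
proof -
  \<comment> \<open>with this \<open>\<kappa>\<close> the factor \<open>1 - n / (\<kappa> (K + 1))\<close> vanishes\<close>
  define \<kappa> where "\<kappa> = n / (real K + 1)"
  define D where "D = V - fps_const (1 / \<kappa>) * (fps_X * fps_deriv V)"
  have \<kappa>: "\<kappa> > 0" "\<kappa> \<le> 1" "\<kappa> * (real K + 1) = n" using n by (auto simp: \<kappa>_def)
  have c0: "0 \<le> fps_nth (V ^ K) i" for i using V by (intro fps_power_nth_nonneg)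
  have D: "fps_nth D i = (1 - i / \<kappa>) * fps_nth V i" for i
    unfolding D_def by (simp add: left_diff_distrib)
  have D0: "fps_nth D i \<le> 0" if "i > 0" for i
    unfolding D using V \<kappa> that by (intro mult_nonpos_nonneg) (auto simp: field_simps)
  have "0 = fps_nth (D * V ^ K) n"
    using euler_operator_power_nth[of \<kappa> V K n] \<kappa> n unfolding D_def by simp
  also have "\<dots> = (\<Sum>i\<le>n. fps_nth D i * fps_nth (V ^ K) (n - i))"
    by (simp add: fps_mult_nth atLeast0AtMost)
  also have "{..n} = insert 0 (insert 1 {2..n})" using n by auto
  also have "(\<Sum>i\<in>insert 0 (insert 1 {2..n}). fps_nth D i * fps_nth (V ^ K) (n - i))
     = fps_nth (V ^ K) n + (1 - 1 / \<kappa>) * fps_nth V 1 * fps_nth (V ^ K) (n - 1)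
       + (\<Sum>i\<in>{2..n}. fps_nth D i * fps_nth (V ^ K) (n - i))"
    by (simp add: D V)
  finally have "(1 / \<kappa> - 1) * fps_nth V 1 * fps_nth (V ^ K) (n - 1)
     = fps_nth (V ^ K) n + (\<Sum>i\<in>{2..n}. fps_nth D i * fps_nth (V ^ K) (n - i))"
    by (simp add: algebra_simps)
  also have "\<dots> \<le> fps_nth (V ^ K) n"
    using D0 c0 by (auto intro!: sum_nonpos mult_nonpos_nonneg)
  finally have 1: "(1 / \<kappa> - 1) * fps_nth V 1 * fps_nth (V ^ K) (n - 1) \<le> fps_nth (V ^ K) n" .
  have "(1 / \<kappa> - 1) * 1 * fps_nth (V ^ K) (n - 1) \<le> (1 / \<kappa> - 1) * fps_nth V 1 * fps_nth (V ^ K) (n - 1)"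
    using V \<kappa> c0 by (intro mult_right_mono mult_left_mono) auto
  with 1 have "n * ((1 / \<kappa> - 1) * fps_nth (V ^ K) (n - 1)) \<le> n * fps_nth (V ^ K) n"
    by (intro mult_left_mono) auto
  moreover have "n * (1 / \<kappa> - 1) = real K + 1 - n" using n by (simp add: \<kappa>_def field_simps)
  ultimately show ?thesis by (simp only: mult.assoc[symmetric])
qed

text \<open>Up to index \<open>(K + 1)/L\<close> the coefficients of \<open>V^K\<close> grow by a
  factor of at least \<open>L - 1\<close> per step. The contributions of the higher coefficients of
  \<open>F\<close> are therefore geometrically damped, and the constant coefficient
  dominates.\<close>

lemma mult_power_initial_lower:
  fixes V F :: "real fps" and L K :: nat
  assumes V: "\<And>i. 0 \<le> fps_nth V i" "fps_nth V 0 = 1" "1 \<le> fps_nth V 1"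
    and L: "L \<ge> 2" "\<And>n. (\<Sum>i\<in>{1..n}. \<bar>fps_nth F i\<bar> * (1 / (real L - 1)) ^ i) \<le> fps_nth F 0 / 2"
    and n: "n * L \<le> K + 1"
  shows "fps_nth F 0 / 2 * fps_nth (V ^ K) n \<le> fps_nth (F * V ^ K) n"
proof -
  let ?c = "\<lambda>i. fps_nth (V ^ K) i" and ?\<epsilon> = "1 / (real L - 1)"
  have c0: "0 \<le> ?c i" for i using V by (intro fps_power_nth_nonneg)
  have step: "?c (n - Suc i) \<le> ?\<epsilon> * ?c (n - i)" if "i < n" for i
  proof -
    let ?k = "n - i"
    have k: "0 < ?k" "?k * L \<le> K + 1" using that order_trans[OF mult_le_mono1[of ?k n L] n] by simp_all
    moreover have "?k * 1 \<le> ?k * L" using L by (intro mult_left_mono) auto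
    ultimately have "?k * 1 \<le> K + 1" by (meson order_trans)
    hence k': "?k \<le> K + 1" by (simp only: mult_1_right)
    have "real (?k * L) \<le> real (K + 1)" using k by (simp only: of_nat_le_iff)
    hence "real ?k * real L \<le> real K + 1" by (simp only: of_nat_mult of_nat_add of_nat_1)
    hence kL: "?k * (real L - 1) \<le> real K + 1 - ?k" by (simp only: right_diff_distrib)
    have "?k * ((real L - 1) * ?c (?k - 1)) \<le> (real K + 1 - ?k) * ?c (?k - 1)"
      using mult_right_mono[OF kL c0[of "?k - 1"]] by (simp add: mult.assoc)
    also have "\<dots> \<le> ?k * ?c ?k" using power_coeff_ratio[OF V k(1) k'] .
    finally have "(real L - 1) * ?c (?k - 1) \<le> ?c ?k" using k(1) by (subst (asm) mult_le_cancel_left_pos) auto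
    thus ?thesis using L by (simp add: field_simps)
  qed
  have geo: "?c (n - i) \<le> ?\<epsilon> ^ i * ?c n" if "i \<le> n" for i
    using that
  proof (induction i)
    case (Suc i)
    have "?c (n - Suc i) \<le> ?\<epsilon> * ?c (n - i)" using Suc by (intro step) auto
    also have "\<dots> \<le> ?\<epsilon> * (?\<epsilon> ^ i * ?c n)" using Suc L by (intro mult_left_mono) auto
    finally show ?case by (simp add: mult_ac)
  qed simp
  have "(\<Sum>i\<in>{1..n}. - (fps_nth F i * ?c (n - i))) \<le> (\<Sum>i\<in>{1..n}. \<bar>fps_nth F i\<bar> * (?\<epsilon> ^ i * ?c n))"
  proof (rule sum_mono)
    fix i assume i: "i \<in> {1..n}"
    have "- (fps_nth F i * ?c (n - i)) \<le> \<bar>fps_nth F i\<bar> * ?c (n - i)"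
      using abs_ge_minus_self[of "fps_nth F i * ?c (n - i)"] c0[of "n - i"] by (simp add: abs_mult)
    also have "\<dots> \<le> \<bar>fps_nth F i\<bar> * (?\<epsilon> ^ i * ?c n)"
      using geo[of i] i by (intro mult_left_mono) auto
    finally show "- (fps_nth F i * ?c (n - i)) \<le> \<bar>fps_nth F i\<bar> * (?\<epsilon> ^ i * ?c n)" .
  qed
  also have "\<dots> = (\<Sum>i\<in>{1..n}. \<bar>fps_nth F i\<bar> * ?\<epsilon> ^ i) * ?c n"
    by (simp add: sum_distrib_right mult.assoc)
  also have "\<dots> \<le> fps_nth F 0 / 2 * ?c n" using L(2) c0 by (intro mult_right_mono) auto
  finally have *: "- (\<Sum>i\<in>{1..n}. fps_nth F i * ?c (n - i)) \<le> fps_nth F 0 / 2 * ?c n"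
    by (simp add: sum_negf)
  have "fps_nth (F * V ^ K) n = (\<Sum>i\<le>n. fps_nth F i * ?c (n - i))"
    by (simp add: fps_mult_nth atLeast0AtMost)
  also have "{..n} = insert 0 {1..n}" by auto
  finally have "fps_nth (F * V ^ K) n = fps_nth F 0 * ?c n + (\<Sum>i\<in>{1..n}. fps_nth F i * ?c (n - i))"
    by simp
  with * show ?thesis by simp
qed

subsection \<open>Rescaling to radius one\<close>

definition fps_rescale :: "real \<Rightarrow> real fps \<Rightarrow> real fps" where
  "fps_rescale r p = Abs_fps (\<lambda>n. fps_nth p n * r ^ n)"

lemma fps_rescale_nth [simp]: "fps_nth (fps_rescale r p) n = fps_nth p n * r ^ n"
  by (simp add: fps_rescale_def)

lemma fps_rescale_mult: "fps_rescale r (p * q) = fps_rescale r p * fps_rescale r q"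
proof (rule fps_ext)
  fix n
  have h: "fps_nth p i * r ^ i * (fps_nth q (n - i) * r ^ (n - i)) = fps_nth p i * fps_nth q (n - i) * r ^ n"
    if "i \<le> n" for i
  proof -
    have "r ^ n = r ^ i * r ^ (n - i)" using that by (simp flip: power_add)
    thus ?thesis by (simp add: mult_ac)
  qed
  show "fps_nth (fps_rescale r (p * q)) n = fps_nth (fps_rescale r p * fps_rescale r q) n"
    by (simp only: fps_mult_nth fps_rescale_nth sum_distrib_right) (intro sum.cong refl h[symmetric], simp)
qed

lemma fps_rescale_power: "fps_rescale r (p ^ n) = fps_rescale r p ^ n"
proof (induction n)
  case 0
  show ?case by (rule fps_ext) simp
qed (simp add: fps_rescale_mult)

lemma fps_rescale_X_deriv: "fps_rescale r (fps_X * fps_deriv p) = fps_X * fps_deriv (fps_rescale r p)"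
  by (rule fps_ext) simp

lemma fps_rescale_sums:
  "ereal \<bar>r\<bar> < fps_conv_radius p \<Longrightarrow> (\<lambda>n. fps_nth (fps_rescale r p) n) sums eval_fps p r"
  using sums_eval_fps[of r p] by simp

text \<open>Stated at the endpoint \<open>t\<close> so that one pair \<open>C\<close>,
  \<open>q\<close> serves all rescalings by \<open>r\<close> in \<open>[0, t]\<close>; uniformity in
  the saddle point rests on this.\<close>

definition geometric_bound :: "real \<Rightarrow> real fps \<Rightarrow> real \<Rightarrow> real \<Rightarrow> bool" where
  "geometric_bound t p C q \<longleftrightarrow> 0 \<le> C \<and> 0 < q \<and> q < 1 \<and> (\<forall>n. \<bar>fps_nth p n\<bar> * t ^ n \<le> C * q ^ n)"

lemma geometric_bound_exists:
  assumes "0 < t" "ereal t < fps_conv_radius p"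
  obtains C q where "geometric_bound t p C q"
proof -
  obtain R where R: "ereal t < ereal R" "ereal R < fps_conv_radius p"
    using ereal_dense2[OF assms(2)] by blast
  have "summable (\<lambda>n. norm (fps_nth p n * R ^ n))"
    using R assms by (intro norm_summable_fps) auto
  hence "Bseq (\<lambda>n. norm (fps_nth p n * R ^ n))"
    by (intro convergent_imp_Bseq convergentI[OF summable_LIMSEQ_zero])
  then obtain C where C: "C > 0" "\<And>n. \<bar>fps_nth p n * R ^ n\<bar> \<le> C"
    unfolding Bseq_def by auto
  \<comment> \<open>The terms at \<open>R\<close>, strictly between \<open>t\<close> and the radius
    of convergence, are bounded; moving back to \<open>t\<close> gains
    \<open>(t/R)^n\<close>.\<close>
  have "geometric_bound t p C (t / R)"
    unfolding geometric_bound_def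
  proof (intro conjI allI)
    fix n
    have "\<bar>fps_nth p n\<bar> * t ^ n = \<bar>fps_nth p n * R ^ n\<bar> * (t / R) ^ n"
      using R assms by (simp add: abs_mult power_divide)
    also have "\<dots> \<le> C * (t / R) ^ n" using C R assms by (intro mult_right_mono) auto
    finally show "\<bar>fps_nth p n\<bar> * t ^ n \<le> C * (t / R) ^ n" .
  qed (use C R assms in auto)
  thus thesis by (rule that)
qed

lemma geometric_bound_rescale:
  assumes "geometric_bound t p C q" "0 \<le> r" "r \<le> t"
  shows "\<bar>fps_nth (fps_rescale r p) n\<bar> \<le> C * q ^ n"
proof -
  have "\<bar>fps_nth p n\<bar> * r ^ n \<le> \<bar>fps_nth p n\<bar> * t ^ n"
    using assms by (intro mult_left_mono power_mono) auto
  also have "\<dots> \<le> C * q ^ n" using assms by (simp add: geometric_bound_def)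
  finally show ?thesis using assms by (simp add: abs_mult)
qed

lemma
  assumes "\<And>n. \<bar>fps_nth p n\<bar> \<le> C * q ^ n" "0 < q" "q < 1"
  shows geometric_imp_l1: "l1 p" and geometric_imp_l1_norm_le: "l1_norm p \<le> C / (1 - q)"
proof -
  have g: "(\<lambda>n. C * q ^ n) sums (C * (1 / (1 - q)))"
    using assms by (intro sums_mult geometric_sums) auto
  show 1: "l1 p" unfolding l1_def
    by (rule summable_comparison_test_ev[OF _ sums_summable[OF g]])
       (auto intro!: always_eventually assms)
  have "l1_norm p \<le> (\<Sum>n. C * q ^ n)"
    using 1 g assms unfolding l1_def l1_norm_def by (intro suminf_le) (auto simp: sums_iff)
  thus "l1_norm p \<le> C / (1 - q)" using g by (simp add: sums_iff)
qed

lemmas geometric_bound_l1 = geometric_imp_l1[OF geometric_bound_rescale]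
lemmas geometric_bound_l1_norm_le = geometric_imp_l1_norm_le[OF geometric_bound_rescale]

text \<open>Division of \<open>p - S\<close> by \<open>1 - X\<close>: the coefficients of
  \<open>G\<close> are negated tails of the sum of \<open>p\<close>. They inherit geometric decay,
  and each of the two summations costs a factor \<open>1/(1 - q)\<close>.\<close>

lemma split_off_one_minus_X:
  assumes p: "\<And>n. \<bar>fps_nth p n\<bar> \<le> C * q ^ n" "0 < q" "q < 1" "0 \<le> C"
    and S: "(\<lambda>n. fps_nth p n) sums S"
  obtains G where "p = fps_const S + (1 - fps_X) * G" "l1 G" "l1_norm G \<le> C / (1 - q)\<^sup>2"
proof -
  define G where "G = Abs_fps (\<lambda>j. (\<Sum>i\<le>j. fps_nth p i) - S)"
  have "p = fps_const S + (1 - fps_X) * G"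
  proof (rule fps_ext)
    fix n show "fps_nth p n = fps_nth (fps_const S + (1 - fps_X) * G) n"
      by (cases n) (simp_all add: G_def left_diff_distrib)
  qed
  moreover have G: "\<bar>fps_nth G j\<bar> \<le> C / (1 - q) * q ^ j" for j
  proof -
    have s: "summable (\<lambda>i. fps_nth p i)" using S by (simp add: sums_iff)
    have ab: "summable (\<lambda>i. \<bar>fps_nth p (i + Suc j)\<bar>)"
      using geometric_imp_l1[OF p(1-3)] unfolding l1_def by (subst summable_iff_shift)
    have g: "(\<lambda>i. C * q ^ Suc j * q ^ i) sums (C * q ^ Suc j * (1 / (1 - q)))"
      using p by (intro sums_mult geometric_sums) auto
    have "\<bar>fps_nth G j\<bar> = \<bar>\<Sum>i. fps_nth p (i + Suc j)\<bar>"
    proof -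
      have "S = (\<Sum>i. fps_nth p (i + Suc j)) + (\<Sum>i<Suc j. fps_nth p i)"
        using suminf_split_initial_segment[OF s, of "Suc j"] S by (simp only: sums_iff)
      hence "fps_nth G j = - (\<Sum>i. fps_nth p (i + Suc j))"
        unfolding G_def by (simp only: lessThan_Suc_atMost) simp
      thus ?thesis by simp
    qed
    also have "\<dots> \<le> (\<Sum>i. \<bar>fps_nth p (i + Suc j)\<bar>)" by (rule summable_rabs[OF ab])
    also have "\<dots> \<le> (\<Sum>i. C * q ^ Suc j * q ^ i)"
    proof (rule suminf_le[OF _ ab])
      fix i show "\<bar>fps_nth p (i + Suc j)\<bar> \<le> C * q ^ Suc j * q ^ i"
        using p(1)[of "i + Suc j"] by (simp add: power_add mult_ac)
    qed (use g in \<open>simp add: sums_iff\<close>)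
    also have "\<dots> = C / (1 - q) * q ^ j * q" using g by (simp add: sums_iff mult_ac)
    also have "\<dots> \<le> C / (1 - q) * q ^ j * 1" using p by (intro mult_left_mono) auto
    finally show ?thesis by simp
  qed
  moreover have "l1 G" by (rule geometric_imp_l1[OF G]) (use p in auto)
  moreover have "l1_norm G \<le> C / (1 - q) / (1 - q)" by (rule geometric_imp_l1_norm_le[OF G]) (use p in auto)
  ultimately show thesis using that[of G] by (simp add: power2_eq_square)
qed

lemma fps_conv_radius_X_deriv: "fps_conv_radius p \<le> fps_conv_radius (fps_X * fps_deriv p)"
  for p :: "real fps"
  using fps_conv_radius_deriv[of p] fps_conv_radius_mult[of fps_X "fps_deriv p"] by simp

text \<open>For \<open>i > 0\<close> the coefficient is \<open>(i/\<kappa> - 1) u_i r^i\<close>,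
  nonnegative as \<open>\<kappa> \<le> 1\<close>; the saddle point equation says that the total mass
  is 1. The lower bound \<open>\<kappa>3\<close> frees the decay constant from
  \<open>\<kappa>\<close>.\<close>

lemma rescaled_kernel:
  fixes u :: "real fps" and r \<kappa> \<kappa>3 t :: real
  defines "a \<equiv> 1 - (fps_rescale r u - fps_const (1 / \<kappa>) * (fps_X * fps_deriv (fps_rescale r u)))"
  assumes u: "\<And>i. 0 \<le> fps_nth u i" "fps_nth u 0 = 1"
    and rad: "ereal t < fps_conv_radius u"
    and B: "geometric_bound t (fps_X * fps_deriv u) C q"
    and r: "0 \<le> r" "r \<le> t" and \<kappa>: "0 < \<kappa>3" "\<kappa>3 \<le> \<kappa>" "\<kappa> \<le> 1"
    and eq: "\<kappa> * eval_fps u r = eval_fps (fps_X * fps_deriv u) r"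
  shows "fps_nth a 0 = 0" "\<And>i. 0 \<le> fps_nth a i" "(\<lambda>i. fps_nth a i) sums 1"
    "\<And>i. fps_nth a i \<le> C / \<kappa>3 * q ^ i"
proof -
  have nth: "fps_nth a i = (if i = 0 then 0 else (i / \<kappa> - 1) * fps_nth u i * r ^ i)" for i
    unfolding a_def using u by (simp add: left_diff_distrib)
  show "fps_nth a 0 = 0" by (simp add: nth)
  show "0 \<le> fps_nth a i" for i
  proof (cases "i = 0")
    case False
    hence "0 \<le> i / \<kappa> - 1" using \<kappa> by (simp add: field_simps)
    thus ?thesis using u r False by (simp add: nth)
  qed (simp add: nth)
  have rr: "ereal \<bar>r\<bar> < fps_conv_radius u"
    using rad r by (metis abs_of_nonneg ereal_less_eq(3) le_less_trans)
  have rr': "ereal \<bar>r\<bar> < fps_conv_radius (fps_X * fps_deriv u)"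
    using rr fps_conv_radius_X_deriv by (rule less_le_trans)
  have "(\<lambda>i. fps_nth (fps_const 1) i) sums (\<Sum>i\<in>{0}. fps_nth (fps_const (1::real)) i)"
    by (intro sums_finite) auto
  hence "(\<lambda>i. fps_nth 1 i - (fps_nth (fps_rescale r u) i - 1 / \<kappa> * fps_nth (fps_rescale r (fps_X * fps_deriv u)) i))
      sums (1 - (eval_fps u r - 1 / \<kappa> * eval_fps (fps_X * fps_deriv u) r))"
    using rr rr' by (intro sums_diff sums_mult fps_rescale_sums) auto
  moreover have "eval_fps u r - 1 / \<kappa> * eval_fps (fps_X * fps_deriv u) r = 0"
    using \<kappa> by (simp add: eq[symmetric])
  ultimately show "(\<lambda>i. fps_nth a i) sums 1"
    unfolding a_def by (simp add: fps_rescale_X_deriv)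
  show "fps_nth a i \<le> C / \<kappa>3 * q ^ i" for i
  proof (cases "i = 0")
    case False
    have "(i / \<kappa> - 1) * (fps_nth u i * r ^ i) \<le> i / \<kappa> * (fps_nth u i * r ^ i)"
      using u r by (intro mult_right_mono) auto
    hence "fps_nth a i \<le> i / \<kappa> * fps_nth u i * r ^ i" using False by (simp add: nth mult.assoc)
    also have "\<dots> = 1 / \<kappa> * (i * fps_nth u i * r ^ i)" by simp
    also have "\<dots> \<le> 1 / \<kappa>3 * (i * fps_nth u i * r ^ i)"
      using \<kappa> u r by (intro mult_right_mono divide_left_mono) auto
    also have "\<dots> \<le> 1 / \<kappa>3 * (C * q ^ i)"
    proof (rule mult_left_mono)
      have "\<bar>i * fps_nth u i * r ^ i\<bar> \<le> C * q ^ i"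
        using geometric_bound_rescale[OF B r, of i] by (simp only: fps_rescale_nth nth_X_times_deriv)
      thus "i * fps_nth u i * r ^ i \<le> C * q ^ i" by linarith
    qed (use \<kappa> in auto)
    finally show ?thesis by simp
  qed (use B \<kappa> in \<open>auto simp: nth geometric_bound_def\<close>)
qed

subsection \<open>Coefficients near a positive saddle point\<close>

lemma eval_fps_ge_nth_0:
  assumes "\<And>i. 0 \<le> fps_nth p i" "0 \<le> r" "ereal r < fps_conv_radius p"
  shows "fps_nth p 0 \<le> eval_fps p r"
proof -
  have s: "(\<lambda>n. fps_nth p n * r ^ n) sums eval_fps p r" using assms by (intro sums_eval_fps) auto
  have "(\<Sum>n\<in>{0}. fps_nth p n * r ^ n) \<le> (\<Sum>n. fps_nth p n * r ^ n)"
    using assms s by (intro sum_le_suminf) (auto simp: sums_iff)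
  thus ?thesis using s by (simp add: sums_iff)
qed

lemma eval_fps_mono:
  assumes "\<And>i. 0 \<le> fps_nth p i" "0 \<le> r" "r \<le> t" "ereal t < fps_conv_radius p"
  shows "eval_fps p r \<le> eval_fps p t"
proof -
  have r: "ereal r < fps_conv_radius p" using assms by (meson ereal_less_eq(3) le_less_trans)
  have s: "(\<lambda>n. fps_nth p n * r ^ n) sums eval_fps p r" "(\<lambda>n. fps_nth p n * t ^ n) sums eval_fps p t"
    using assms r by (auto intro!: sums_eval_fps)
  have "fps_nth p n * r ^ n \<le> fps_nth p n * t ^ n" for n
    using assms by (intro mult_left_mono power_mono) auto
  thus ?thesis using s by (rule sums_le)
qed

text \<open>For saddle points bounded away from 0. The thresholds \<open>K1\<close> and
  \<open>m0\<close> precede \<open>r\<close>, \<open>\<kappa>\<close> and \<open>k\<close>, which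
  enter only through uniform bounds. The slack \<open>K + 2\<close> leaves room for the index
  \<open>m + K + 2\<close> at \<open>\<kappa> = 1\<close>.\<close>

lemma middle_regime:
  fixes u V F :: "real fps" and r2 t f0 \<kappa>3 :: real
  assumes u: "\<And>i. 0 \<le> fps_nth u i" "fps_nth u 0 = 1" "ereal t < fps_conv_radius u"
    and V: "\<And>i. 0 \<le> fps_nth V i" "fps_nth V 0 = 1" "1 \<le> fps_nth V 1" "ereal t < fps_conv_radius V"
    and F: "ereal t < fps_conv_radius F"
    and r2: "0 < r2" "r2 \<le> t" and f0: "0 < f0" and \<kappa>3: "0 < \<kappa>3"
  shows "\<exists>K1. \<forall>K\<ge>K1. \<exists>m0. \<forall>m\<ge>m0. \<forall>r \<kappa> k. r2 \<le> r \<longrightarrow> r \<le> t \<longrightarrow> f0 \<le> eval_fps F r \<longrightarrow>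
     \<kappa>3 \<le> \<kappa> \<longrightarrow> \<kappa> \<le> 1 \<longrightarrow> \<kappa> * eval_fps u r = eval_fps (fps_X * fps_deriv u) r \<longrightarrow>
     \<bar>real k - \<kappa> * (real m + 1)\<bar> \<le> real K + 2 \<longrightarrow> 0 < fps_nth (F * V ^ K * u ^ m) k"
proof -
  have t: "0 < t" using r2 by simp
  obtain Cu qu where Bu: "geometric_bound t u Cu qu" using geometric_bound_exists[OF t u(3)] .
  obtain C q where B: "geometric_bound t (fps_X * fps_deriv u) C q"
    using geometric_bound_exists[OF t less_le_trans[OF u(3) fps_conv_radius_X_deriv]] .
  obtain CV qV where BV: "geometric_bound t (fps_X * fps_deriv V) CV qV"
    using geometric_bound_exists[OF t less_le_trans[OF V(4) fps_conv_radius_X_deriv]] .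
  obtain CF qF where BF: "geometric_bound t F CF qF" using geometric_bound_exists[OF t F] .
  have q: "0 < q" "q < 1" "0 \<le> C" and qu: "0 < qu" "qu < 1" "0 \<le> Cu" and qV: "0 < qV" "qV < 1" "0 \<le> CV"
    and qF: "0 < qF" "qF < 1" "0 \<le> CF"
    using B Bu BV BF by (simp_all add: geometric_bound_def)
  define U where "U = Cu / (1 - qu)"
  define \<mu> where "\<mu> = CV / (1 - qV)"
  define FN where "FN = CF / (1 - qF)"
  define CG where "CG = CF / (1 - qF)\<^sup>2"
  define Vt where "Vt = eval_fps V t"
  \<comment> \<open>A lower bound, valid for all \<open>r\<close> in \<open>[r2, t]\<close>, for the
    first two coefficients of \<open>V(r X) / V(r)\<close>.\<close>
  define b where "b = min 1 r2 / Vt"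
  have pos: "0 \<le> U" "0 \<le> \<mu>" "0 \<le> FN" "0 \<le> CG"
    unfolding U_def \<mu>_def FN_def CG_def using qu qV qF by auto
  have Vt: "1 \<le> Vt" unfolding Vt_def using eval_fps_ge_nth_0[of V t] V t by simp
  have b: "0 < b" unfolding b_def using r2 Vt by simp
  \<comment> \<open>The window length \<open>J\<close> has to be fixed before \<open>K\<close>; it
    depends only on \<open>C\<close>, \<open>q\<close> and \<open>\<kappa>3\<close>.\<close>
  have "(\<lambda>J. q ^ (J + 2)) \<longlonglongrightarrow> 0"
    using q by (intro LIMSEQ_ignore_initial_segment[OF LIMSEQ_power_zero]) auto
  from tendsto_mult_left[OF this, of "C / \<kappa>3 / (1 - q)\<^sup>2"]
  have "(\<lambda>J. C / \<kappa>3 / (1 - q)\<^sup>2 * q ^ (J + 2)) \<longlonglongrightarrow> 0" by simp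
  hence "eventually (\<lambda>J. C / \<kappa>3 / (1 - q)\<^sup>2 * q ^ (J + 2) < 1 / 2) sequentially"
    by (rule order_tendstoD) simp
  then obtain J where "C / \<kappa>3 / (1 - q)\<^sup>2 * q ^ (J + 2) < 1 / 2"
    unfolding eventually_sequentially by blast
  hence J: "C / \<kappa>3 * q ^ (J + 2) / (1 - q)\<^sup>2 \<le> 1 / 2" by simp
  define \<eta> where "\<eta> = f0 * b ^ J / 8"
  have \<eta>: "0 < \<eta>" unfolding \<eta>_def using f0 b by simp
  \<comment> \<open>\<open>CG \<delta>\<close> uses up at most half of the error allowance
    \<open>\<eta>\<close>; the rest of the smoothing bound tends to 0 as \<open>K\<close>
    grows.\<close>
  define \<delta> where "\<delta> = \<eta> / (2 * (CG + 1))"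
  have \<delta>: "0 < \<delta>" unfolding \<delta>_def using \<eta> pos by simp
  have lim: "(\<lambda>K. CG * (\<delta> + 1 / (2 * \<delta> * b) * inverse (real (Suc K)))) \<longlonglongrightarrow> CG * (\<delta> + 1 / (2 * \<delta> * b) * 0)"
    by (rule tendsto_mult_left[OF tendsto_add[OF tendsto_const tendsto_mult_left[OF LIMSEQ_inverse_real_of_nat]]])
  have "CG * \<delta> \<le> (CG + 1) * \<delta>" using \<delta> by (simp add: algebra_simps)
  moreover have "(CG + 1) * \<delta> = \<eta> / 2"
    unfolding \<delta>_def using pos(4) by (simp add: add_nonneg_eq_0_iff divide_simps)
  ultimately have "CG * (\<delta> + 1 / (2 * \<delta> * b) * 0) < \<eta>" using \<eta> by simp
  from order_tendstoD(2)[OF lim this, unfolded eventually_sequentially]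
  obtain K' where K': "\<forall>K\<ge>K'. CG * (\<delta> + 1 / (2 * \<delta> * b) * inverse (real (Suc K))) < \<eta>" ..
  show ?thesis
  proof (rule exI[of _ "max K' J"], intro allI impI)
    fix K assume K: "max K' J \<le> K"
    have \<delta>K: "CG * (\<delta> + 1 / (2 * \<delta> * b * (K + 1))) \<le> f0 * b ^ J / 8"
    proof -
      have "1 / (2 * \<delta> * b * (K + 1)) = 1 / (2 * \<delta> * b) * inverse (real (Suc K))"
        unfolding divide_inverse inverse_mult_distrib by simp
      moreover have "CG * (\<delta> + 1 / (2 * \<delta> * b) * inverse (real (Suc K))) < \<eta>"
        using K by (intro K'[rule_format]) simp
      ultimately show ?thesis unfolding \<eta>_def[symmetric] by (simp only: less_imp_le)
    qed
    \<comment> \<open>Exceeds \<open>2 K \<mu> + J\<close>, as Markov's inequality requires, and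
      also the slack \<open>K + 2\<close>.\<close>
    define n0 where "n0 = nat \<lceil>2 * (K * \<mu>)\<rceil> + J + K + 3"
    obtain m0 where m0: "real m0 > (FN + \<eta>) * (n0 * (n0 + (K + 2))) * U / (\<eta> * \<kappa>3)"
      using reals_Archimedean2 by blast
    show "\<exists>m0. \<forall>m\<ge>m0. \<forall>r \<kappa> k. r2 \<le> r \<longrightarrow> r \<le> t \<longrightarrow> f0 \<le> eval_fps F r \<longrightarrow>
       \<kappa>3 \<le> \<kappa> \<longrightarrow> \<kappa> \<le> 1 \<longrightarrow> \<kappa> * eval_fps u r = eval_fps (fps_X * fps_deriv u) r \<longrightarrow>
       \<bar>real k - \<kappa> * (real m + 1)\<bar> \<le> real K + 2 \<longrightarrow> 0 < fps_nth (F * V ^ K * u ^ m) k"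
    proof (intro exI[of _ m0] allI impI)
      fix m r \<kappa> k
      assume m: "m0 \<le> m" and r: "r2 \<le> r" "r \<le> t" and Fr: "f0 \<le> eval_fps F r"
        and \<kappa>: "\<kappa>3 \<le> \<kappa>" "\<kappa> \<le> 1" and eq: "\<kappa> * eval_fps u r = eval_fps (fps_X * fps_deriv u) r"
        and k: "\<bar>real k - \<kappa> * (real m + 1)\<bar> \<le> real K + 2"
      have r0: "0 \<le> r" "0 < r" using r r2 by auto
      have rad: "ereal \<bar>r\<bar> < fps_conv_radius p" if "ereal t < fps_conv_radius p" for p :: "real fps"
        using that r r0 by (metis abs_of_nonneg ereal_less_eq(3) le_less_trans)
      define Vr where "Vr = eval_fps V r"
      have Vr: "1 \<le> Vr" "Vr \<le> Vt"
        unfolding Vr_def Vt_def using eval_fps_ge_nth_0[of V r] eval_fps_mono[of V r t] V r r0 rad[OF V(4)] by auto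
      define u' where "u' = fps_rescale r u"
      \<comment> \<open>Normalized to total mass 1, so that the probabilistic lemmas apply; the
        positive factor \<open>Vr^K\<close> does not affect signs.\<close>
      define W where "W = fps_const (1 / Vr) * fps_rescale r V"
      define F' where "F' = fps_rescale r F"
      define a where "a = 1 - (u' - fps_const (1 / \<kappa>) * (fps_X * fps_deriv u'))"
      define d where "d = inverse (1 - a)"
      note ker = rescaled_kernel[OF u B r0(1) r(2) \<kappa>3 \<kappa> eq, folded u'_def, folded a_def]
      have d: "0 \<le> fps_nth d i" "fps_nth d i \<le> 1" for i
        unfolding d_def using renewal_nonneg[OF ker(1-3)] renewal_le_1[OF ker(1-3)] by auto
      have dw: "1 / 2 \<le> (\<Sum>j\<le>J. fps_nth d (n - j))" if "J \<le> n" for n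
        unfolding d_def by (rule renewal_window[OF ker(1-3) q(1,2) ker(4) J that])
      have W: "0 \<le> fps_nth W i" for i unfolding W_def using V r0 Vr by simp
      have W1: "(\<lambda>i. fps_nth W i) sums 1"
        using sums_mult[OF fps_rescale_sums[OF rad[OF V(4)]], of "1 / Vr"] Vr unfolding W_def Vr_def by simp
      have bW: "b \<le> fps_nth W 0" "b \<le> fps_nth W 1"
      proof -
        have "b \<le> min 1 r2 / Vr" unfolding b_def using Vr r2 by (intro divide_left_mono) auto
        moreover have "min 1 r2 / Vr \<le> 1 / Vr" "min 1 r2 / Vr \<le> fps_nth V 1 * r / Vr"
          using Vr r r0 V(3) mult_mono[of 1 "fps_nth V 1" r2 r] r2 by (auto intro!: divide_right_mono)
        ultimately show "b \<le> fps_nth W 0" "b \<le> fps_nth W 1" unfolding W_def using V by simp_all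
      qed
      have WX: "fps_X * fps_deriv W = fps_const (1 / Vr) * fps_rescale r (fps_X * fps_deriv V)"
        unfolding W_def by (rule fps_ext) (simp add: fps_rescale_X_deriv)
      have lV: "l1 (fps_rescale r (fps_X * fps_deriv V))" "l1_norm (fps_rescale r (fps_X * fps_deriv V)) \<le> \<mu>"
        unfolding \<mu>_def using geometric_bound_l1[OF BV r0(1) r(2)] geometric_bound_l1_norm_le[OF BV r0(1) r(2)] qV by auto
      have \<mu>W: "l1 (fps_X * fps_deriv W)" "l1_norm (fps_X * fps_deriv W) \<le> \<mu>"
      proof -
        show "l1 (fps_X * fps_deriv W)" unfolding WX by (rule l1_mult[OF l1_const lV(1)])
        have "l1_norm (fps_X * fps_deriv W) \<le> \<bar>1 / Vr\<bar> * l1_norm (fps_rescale r (fps_X * fps_deriv V))"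
          unfolding WX using l1_norm_mult_le[OF l1_const lV(1), of "1 / Vr"] by simp
        also have "\<dots> \<le> 1 * \<mu>" using Vr lV pos l1_norm_nonneg[OF lV(1)] by (intro mult_mono) auto
        finally show "l1_norm (fps_X * fps_deriv W) \<le> \<mu>" by simp
      qed
      obtain G where G: "F' = fps_const (eval_fps F r) + (1 - fps_X) * G" "l1 G" "l1_norm G \<le> CG"
        using split_off_one_minus_X[of F' CF qF "eval_fps F r"] geometric_bound_rescale[OF BF r0(1) r(2)] qF
          fps_rescale_sums[OF rad[OF F]] unfolding F'_def CG_def by metis
      have low: "\<eta> \<le> fps_nth (F' * W ^ K * d) n" if "n \<ge> n0" for n
        unfolding \<eta>_def
      proof (rule quotient_lower[OF W W1 b bW \<mu>W d dw G Fr f0 \<delta> \<delta>K])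
        show "J \<le> K" using K by simp
        show "J < n" using that unfolding n0_def by simp
        have "2 * (K * \<mu>) \<le> nat \<lceil>2 * (K * \<mu>)\<rceil>" by linarith
        also have "\<dots> \<le> n - J" using that unfolding n0_def by simp
        finally show "2 * (K * \<mu>) \<le> n - J" .
      qed
      have lF: "l1 F'" "l1_norm F' \<le> FN"
        unfolding F'_def FN_def using geometric_bound_l1[OF BF r0(1) r(2)] geometric_bound_l1_norm_le[OF BF r0(1) r(2)] qF by auto
      have lu: "l1 u'" "l1_norm u' \<le> U"
        unfolding u'_def U_def using geometric_bound_l1[OF Bu r0(1) r(2)] geometric_bound_l1_norm_le[OF Bu r0(1) r(2)] qu by auto
      note lW = nonneg_sums_imp_l1[OF W W1]
      have up: "\<bar>fps_nth (F' * W ^ K * d) i\<bar> \<le> FN" for i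
      proof -
        have "\<bar>fps_nth (F' * W ^ K * d) i\<bar> \<le> l1_norm (F' * W ^ K)"
          using d by (intro abs_mult_nth_le_l1_norm l1_mult lF l1_power lW) auto
        also have "\<dots> \<le> l1_norm F' * l1_norm (W ^ K)" by (intro l1_norm_mult_le lF l1_power lW)
        also have "\<dots> \<le> FN * 1"
          using lF pos l1_norm_power_le[OF lW(1), of K] lW(2)
          by (intro mult_mono) (auto intro!: l1_norm_nonneg l1_power lW)
        finally show ?thesis by simp
      qed
      have "(FN + \<eta>) * (n0 * (n0 + (K + 2))) * l1_norm u' \<le> (FN + \<eta>) * (n0 * (n0 + (K + 2))) * U"
        using lu pos \<eta> by (intro mult_left_mono) auto
      also have "\<dots> < \<eta> * \<kappa>3 * m0"
        using m0 \<eta> \<kappa>3 by (subst (asm) pos_divide_less_eq) (auto simp: mult_ac)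
      also have "\<dots> \<le> \<eta> * \<kappa> * (m + 1)"
        using m \<eta> \<kappa>3 \<kappa> by (intro mult_mono) auto
      finally have big: "(FN + \<eta>) * (n0 * (n0 + (K + 2))) * l1_norm u' < \<eta> * (\<kappa> * (m + 1))"
        by (simp only: mult.assoc)
      have u': "0 \<le> fps_nth u' i" "fps_nth u' 0 = 1" for i using u r0 by (auto simp: u'_def)
      have k': "\<bar>real k - \<kappa> * real (m + 1)\<bar> \<le> real (K + 2)" using k by (simp add: add.commute)
      have \<kappa>0: "0 < \<kappa>" using \<kappa> \<kappa>3 by simp
      have sn: "K + 2 \<le> n0" unfolding n0_def by simp
      have "0 < fps_nth (F' * W ^ K * u' ^ m) k"
        using coeff_pos_of_quotient[OF u' lu(1) ker(2)[unfolded a_def] ker(3)[unfolded a_def] \<kappa>0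
            up[unfolded d_def a_def] low[unfolded d_def a_def] sn k' \<eta> big] .
      also have "F' * W ^ K * u' ^ m = fps_const (1 / Vr ^ K) * fps_rescale r (F * V ^ K * u ^ m)"
        unfolding F'_def W_def u'_def
        by (simp add: fps_rescale_mult fps_rescale_power power_mult_distrib fps_const_power power_one_over mult_ac)
      finally show "0 < fps_nth (F * V ^ K * u ^ m) k"
        using Vr r0 by (simp add: zero_less_mult_iff zero_less_divide_iff)
    qed
  qed
qed

subsection \<open>Coefficients near the saddle point zero\<close>

text \<open>Both \<open>\<phi>/(1 - a)\<close> and, up to index \<open>\<kappa> (m + 1)\<close>,
  also \<open>(1 - a) u^m\<close> have nonnegative coefficients. There is no error term, so every
  \<open>m\<close> is covered.\<close>

lemma coeff_nonneg_of_quotient: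
  fixes u \<phi> :: "real fps" and \<kappa> :: real
  defines "a \<equiv> 1 - (u - fps_const (1 / \<kappa>) * (fps_X * fps_deriv u))"
  assumes u: "\<And>i. 0 \<le> fps_nth u i" "fps_nth u 0 = 1" and \<kappa>: "\<kappa> > 0"
    and \<psi>: "\<And>i. 0 \<le> fps_nth (\<phi> * inverse (1 - a)) i" and k: "real k \<le> \<kappa> * (real m + 1)"
  shows "0 \<le> fps_nth (\<phi> * u ^ m) k"
proof -
  have a0: "fps_nth a 0 = 0" unfolding a_def using u by simp
  have d1a: "inverse (1 - a) * (1 - a) = 1" using a0 by (intro inverse_mult_eq_1) simp
  have "\<phi> * inverse (1 - a) * ((1 - a) * u ^ m) = \<phi> * u ^ m * (inverse (1 - a) * (1 - a))"
    by (simp only: mult_ac)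
  hence eq: "\<phi> * u ^ m = \<phi> * inverse (1 - a) * ((1 - a) * u ^ m)" by (simp only: d1a mult_1_right)
  have "0 \<le> fps_nth ((1 - a) * u ^ m) n" if "n \<le> k" for n
  proof -
    have "fps_nth ((1 - a) * u ^ m) n = (1 - n / (\<kappa> * (m + 1))) * fps_nth (u ^ Suc m) n"
      unfolding a_def using euler_operator_power_nth[of \<kappa> u m n] \<kappa> by simp
    moreover have "real n \<le> \<kappa> * (real m + 1)" using that k by simp
    ultimately show ?thesis
      using u \<kappa> fps_power_nth_nonneg[OF u(1), of "Suc m" n] by (simp add: zero_le_mult_iff add.commute)
  qed
  thus ?thesis unfolding eq fps_mult_nth[of "\<phi> * inverse (1 - a)"]
    using \<psi> by (intro sum_nonneg mult_nonneg_nonneg) auto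
qed

text \<open>One fixed small \<open>r\<close> serves all \<open>k\<close> up to
  \<open>\<kappa> (m + 1)\<close>, hence also saddle points approaching 0. For large
  \<open>K\<close> the rescaled \<open>F V^K\<close> is nonnegative up to an index of order
  \<open>K/L\<close>, and its later coefficients have exponentially small total mass, less than what
  a renewal window yields.\<close>

lemma small_regime:
  fixes u V F :: "real fps" and t :: real
  assumes u: "\<And>i. 0 \<le> fps_nth u i" "fps_nth u 0 = 1" "ereal t < fps_conv_radius u"
    and V: "\<And>i. 0 \<le> fps_nth V i" "fps_nth V 0 = 1" "1 \<le> fps_nth V 1" "ereal t < fps_conv_radius V"
    and F: "ereal t < fps_conv_radius F" "0 < fps_nth F 0" and t: "0 < t"
  shows "\<exists>\<rho>>0. \<forall>r \<kappa>. 0 < r \<longrightarrow> r \<le> \<rho> \<longrightarrow> r \<le> t \<longrightarrow> 0 < \<kappa> \<longrightarrow> \<kappa> \<le> 1 \<longrightarrow>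
     \<kappa> * eval_fps u r = eval_fps (fps_X * fps_deriv u) r \<longrightarrow>
     (\<exists>K0. \<forall>K\<ge>K0. \<forall>m k. real k \<le> \<kappa> * (real m + 1) \<longrightarrow> 0 \<le> fps_nth (F * V ^ K * u ^ m) k)"
proof -
  obtain C q where B: "geometric_bound t (fps_X * fps_deriv u) C q"
    using geometric_bound_exists[OF t less_le_trans[OF u(3) fps_conv_radius_X_deriv]] .
  obtain CF qF where BF: "geometric_bound t F CF qF" using geometric_bound_exists[OF t F(1)] .
  have q: "0 < q" "q < 1" "0 \<le> C" and qF: "0 < qF" "qF < 1" "0 \<le> CF"
    using B BF by (simp_all add: geometric_bound_def)
  define FN where "FN = CF / (1 - qF)"
  define Vt where "Vt = eval_fps V t"
  have Vt: "1 \<le> Vt" unfolding Vt_def using eval_fps_ge_nth_0[of V t] V t by simp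
  have FN0: "0 \<le> FN" unfolding FN_def using qF by simp
  define F0 where "F0 = fps_nth F 0"
  have F0: "0 < F0" unfolding F0_def by (rule F)
  \<comment> \<open>Large enough to give both \<open>x \<le> 1/2\<close> and
    \<open>2 CF x \<le> F0 / 2\<close> below.\<close>
  obtain L' :: nat where L': "1 + 2 * (qF / t) + 4 * CF * (qF / t) / F0 < L'" using reals_Archimedean2 by blast
  define L where "L = L' + 1"
  have L1: "1 + 2 * (qF / t) + 4 * CF * (qF / t) / F0 < real L - 1" unfolding L_def using L' by simp
  have nn: "0 \<le> qF / t" "0 \<le> CF * (qF / t)" using qF t by auto
  have nn2: "0 \<le> 4 * CF * (qF / t) / F0" using qF t F0 by (intro divide_nonneg_pos mult_nonneg_nonneg divide_nonneg_nonneg) auto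
  have L2: "2 \<le> L" using L1 nn nn2 by (simp add: L_def)
  have Lp: "0 < real L - 1" using L2 by simp
  define x where "x = qF / t / (real L - 1)"
  have x0: "0 < x" unfolding x_def using qF t Lp by simp
  have half: "2 * y \<le> w \<Longrightarrow> y \<le> 1 / 2 * w" for y w :: real by simp
  have "2 * (qF / t) \<le> real L - 1" using L1 nn nn2 by linarith
  hence x2: "x \<le> 1 / 2" unfolding x_def by (subst pos_divide_le_eq[OF Lp]) (rule half)
  have "4 * CF * (qF / t) / F0 \<le> real L - 1" using L1 nn nn2 by linarith
  hence "4 * CF * (qF / t) \<le> (real L - 1) * F0" using F0 by (simp only: pos_divide_le_eq)
  hence "4 * CF * (qF / t) / (real L - 1) \<le> F0" by (simp only: pos_divide_le_eq[OF Lp] mult.commute[of F0])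
  moreover have "CF * (x * 2) = (4 * CF * (qF / t) / (real L - 1)) / 2" unfolding x_def by simp
  ultimately have x4: "CF * (x * 2) \<le> F0 / 2" by (metis divide_right_mono zero_le_numeral)
  have Fsum: "(\<Sum>i\<in>{1..n}. \<bar>fps_nth F i\<bar> * (1 / (real L - 1)) ^ i) \<le> fps_nth F 0 / 2" for n
  proof -
    have "(\<Sum>i\<in>{1..n}. \<bar>fps_nth F i\<bar> * (1 / (real L - 1)) ^ i) \<le> (\<Sum>i\<in>{1..n}. CF * x ^ i)"
    proof (rule sum_mono)
      fix i
      have "\<bar>fps_nth F i\<bar> * t ^ i \<le> CF * qF ^ i" using BF by (simp add: geometric_bound_def)
      hence "\<bar>fps_nth F i\<bar> \<le> CF * (qF / t) ^ i" using t by (simp add: power_divide pos_le_divide_eq)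
      hence "\<bar>fps_nth F i\<bar> * (1 / (real L - 1)) ^ i \<le> CF * (qF / t) ^ i * (1 / (real L - 1)) ^ i"
        using Lp by (intro mult_right_mono) auto
      thus "\<bar>fps_nth F i\<bar> * (1 / (real L - 1)) ^ i \<le> CF * x ^ i"
        unfolding x_def by (simp add: power_divide power_mult_distrib)
    qed
    also have "\<dots> = CF * (\<Sum>i\<in>{1..n}. x ^ i)" by (simp add: sum_distrib_left)
    also have "\<dots> \<le> CF * (x ^ 1 / (1 - x))"
      using x0 x2 qF by (intro mult_left_mono geometric_tail_sum) auto
    also have "\<dots> \<le> CF * (x * 2)"
    proof -
      have "1 / (1 - x) \<le> 2" using x2 by (subst pos_divide_le_eq) auto
      hence "x * (1 / (1 - x)) \<le> x * 2" using x0 by (intro mult_left_mono) auto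
      thus ?thesis using qF by (intro mult_left_mono) auto
    qed
    also note x4
    finally show ?thesis unfolding F0_def .
  qed
  \<comment> \<open>With \<open>L (I + 1) \<ge> K\<close> this gives
    \<open>z^(I+1) \<le> (1/(2 Vt))^K\<close>, which beats the growth \<open>Vt^K\<close> of the
    norm at \<open>t\<close> by a factor \<open>2^K\<close>.\<close>
  define z where "z = (1 / (2 * Vt)) ^ L"
  have z: "0 < z" "z \<le> 1" unfolding z_def using Vt by (auto intro!: power_le_one)
  show ?thesis
  proof (rule exI[of _ "t * z"], intro conjI allI impI)
    show "0 < t * z" using t z by simp
    fix r \<kappa>
    assume r: "0 < r" "r \<le> t * z" "r \<le> t" and \<kappa>: "0 < \<kappa>" "\<kappa> \<le> 1"
      and eq: "\<kappa> * eval_fps u r = eval_fps (fps_X * fps_deriv u) r"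
    have r0: "0 \<le> r" using r by simp
    define u' where "u' = fps_rescale r u"
    define a where "a = 1 - (u' - fps_const (1 / \<kappa>) * (fps_X * fps_deriv u'))"
    define d where "d = inverse (1 - a)"
    note ker = rescaled_kernel[OF u B r0 r(3) \<kappa>(1) order_refl \<kappa>(2) eq, folded u'_def, folded a_def]
    have d: "0 \<le> fps_nth d i" "fps_nth d i \<le> 1" for i
      unfolding d_def using renewal_nonneg[OF ker(1-3)] renewal_le_1[OF ker(1-3)] by auto
    have "(\<lambda>J. q ^ (J + 2)) \<longlonglongrightarrow> 0"
      using q by (intro LIMSEQ_ignore_initial_segment[OF LIMSEQ_power_zero]) auto
    from tendsto_mult_left[OF this, of "C / \<kappa> / (1 - q)\<^sup>2"]
    have "(\<lambda>J. C / \<kappa> / (1 - q)\<^sup>2 * q ^ (J + 2)) \<longlonglongrightarrow> 0" by simp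
    hence "eventually (\<lambda>J. C / \<kappa> / (1 - q)\<^sup>2 * q ^ (J + 2) < 1 / 2) sequentially"
      by (rule order_tendstoD) simp
    then obtain J where "C / \<kappa> / (1 - q)\<^sup>2 * q ^ (J + 2) < 1 / 2"
      unfolding eventually_sequentially by blast
    hence J: "C / \<kappa> * q ^ (J + 2) / (1 - q)\<^sup>2 \<le> 1 / 2" by simp
    have dw: "1 / 2 \<le> (\<Sum>j\<le>J. fps_nth d (n - j))" if "J \<le> n" for n
      unfolding d_def by (rule renewal_window[OF ker(1-3) q(1,2) ker(4) J that])
    \<comment> \<open>Bounds \<open>r^i\<close> from below for all \<open>i \<le> J\<close>, whether
      or not \<open>r\<close> exceeds 1.\<close>
    define \<beta> where "\<beta> = (min 1 r) ^ J"
    have \<beta>: "0 < \<beta>" unfolding \<beta>_def using r by simp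
    have "(\<lambda>K. (1 / 2 :: real) ^ K) \<longlonglongrightarrow> 0" by (intro LIMSEQ_power_zero) simp
    from tendsto_mult_left[OF this, of FN] have "(\<lambda>K. FN * (1 / 2) ^ K) \<longlonglongrightarrow> 0" by simp
    hence "eventually (\<lambda>K. FN * (1 / 2) ^ K < F0 * \<beta> / 4) sequentially"
      by (rule order_tendstoD) (use F0 \<beta> in simp)
    then obtain K0 where K0: "\<forall>K\<ge>K0. FN * (1 / 2) ^ K < F0 * \<beta> / 4"
      unfolding eventually_sequentially by blast
    show "\<exists>K0. \<forall>K\<ge>K0. \<forall>m k. real k \<le> \<kappa> * (real m + 1) \<longrightarrow> 0 \<le> fps_nth (F * V ^ K * u ^ m) k"
    proof (rule exI[of _ "max K0 (J * L)"], intro allI impI)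
      fix K m k :: nat
      assume K: "max K0 (J * L) \<le> K" and k: "real k \<le> \<kappa> * (real m + 1)"
      define \<phi> where "\<phi> = fps_rescale r (F * V ^ K)"
      \<comment> \<open>The last index to which the lower bound by \<open>F0 / 2\<close>
        extends.\<close>
      define I where "I = (K + 1) div L"
      have IL: "I * L \<le> K + 1" unfolding I_def by simp
      have IL2: "K \<le> L * (I + 1)"
      proof -
        have "(K + 1) mod L < L" using L2 by simp
        moreover have "K + 1 = L * I + (K + 1) mod L" unfolding I_def by simp
        ultimately have "K + 1 < L * I + L" by linarith
        thus ?thesis by simp
      qed
      have JI: "J \<le> I" unfolding I_def using K L2 by (simp add: less_eq_div_iff_mult_less_eq)
      have "J * 1 \<le> J * L" using L2 by (intro mult_left_mono) auto
      also have "J * L \<le> K" using K by simp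
      finally have JK: "J \<le> K" by (simp only: mult_1_right)
      have c0: "0 \<le> fps_nth (V ^ K) i" for i using V by (intro fps_power_nth_nonneg)
      have low: "F0 / 2 * fps_nth (V ^ K) i * r ^ i \<le> fps_nth \<phi> i" if "i \<le> I" for i
      proof -
        have "i * L \<le> K + 1" using that IL order_trans[OF mult_le_mono1[of i I L]] by blast
        from mult_power_initial_lower[OF V(1-3) L2 Fsum this]
        show ?thesis unfolding \<phi>_def F0_def fps_rescale_nth using r0 by (intro mult_right_mono) auto
      qed
      have low0: "0 \<le> fps_nth \<phi> i" if "i \<le> I" for i
      proof -
        have "0 \<le> F0 / 2 * fps_nth (V ^ K) i * r ^ i" using F0 c0 r0 by (intro mult_nonneg_nonneg) auto
        thus ?thesis using low[OF that] by linarith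
      qed
      have lowJ: "F0 / 2 * \<beta> \<le> fps_nth \<phi> i" if "i \<le> J" for i
      proof -
        have "1 \<le> real (K choose i)" using that JK by (simp add: Suc_leI)
        also have "real (K choose i) = fps_nth ((1 + fps_X) ^ K) i" by (simp add: one_plus_X_power_nth)
        also have "\<dots> \<le> fps_nth (V ^ K) i"
        proof (rule fps_power_nth_mono)
          fix n show "0 \<le> fps_nth (1 + fps_X :: real fps) n" by (simp add: fps_X_def)
          show "fps_nth (1 + fps_X) n \<le> fps_nth V n"
            using V by (cases "n = 0"; cases "n = 1") (auto simp: fps_X_def)
        qed
        finally have 1: "1 \<le> fps_nth (V ^ K) i" .
        have "\<beta> \<le> (min 1 r) ^ i" unfolding \<beta>_def using that r by (intro power_decreasing) auto
        also have "\<dots> \<le> r ^ i" using r by (intro power_mono) auto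
        finally have 2: "\<beta> \<le> r ^ i" .
        have "F0 / 2 * 1 * \<beta> \<le> F0 / 2 * fps_nth (V ^ K) i * r ^ i"
          using F0 1 2 \<beta> c0 by (intro mult_mono) auto
        also have "\<dots> \<le> fps_nth \<phi> i" using that JI by (intro low) simp
        finally show ?thesis by simp
      qed
      have tail: "(\<Sum>i\<in>{I<..n}. \<bar>fps_nth \<phi> i\<bar>) \<le> FN * (1 / 2) ^ K" for n
      proof -
        have lF: "l1 (fps_rescale t F)" "l1_norm (fps_rescale t F) \<le> FN"
          unfolding FN_def using geometric_bound_l1[OF BF] geometric_bound_l1_norm_le[OF BF] t qF by auto
        have lV: "l1 (fps_rescale t V)" "l1_norm (fps_rescale t V) = Vt"
          unfolding Vt_def using nonneg_sums_imp_l1[of "fps_rescale t V" "eval_fps V t"]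
            fps_rescale_sums[of t V] V t by auto
        have eq: "fps_rescale t (F * V ^ K) = fps_rescale t F * fps_rescale t V ^ K"
          by (simp add: fps_rescale_mult fps_rescale_power)
        have lFV: "l1 (fps_rescale t (F * V ^ K))" unfolding eq by (intro l1_mult lF l1_power lV)
        have "l1_norm (fps_rescale t (F * V ^ K)) \<le> l1_norm (fps_rescale t F) * l1_norm (fps_rescale t V ^ K)"
          unfolding eq by (intro l1_norm_mult_le lF l1_power lV)
        also have "\<dots> \<le> FN * Vt ^ K"
          using lF FN0 l1_norm_power_le[OF lV(1), of K] lV(2)
          by (intro mult_mono) (auto intro!: l1_norm_nonneg l1_power lV)
        finally have N: "l1_norm (fps_rescale t (F * V ^ K)) \<le> FN * Vt ^ K" .
        have "r / t \<le> z" using r t by (simp add: pos_divide_le_eq mult.commute)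
        have "\<bar>fps_nth \<phi> i\<bar> \<le> \<bar>fps_nth (fps_rescale t (F * V ^ K)) i\<bar> * z ^ (I + 1)" if "i \<in> {I<..n}" for i
        proof -
          have "(r / t) ^ i \<le> z ^ i" using r t \<open>r / t \<le> z\<close> by (intro power_mono) auto
          also have "\<dots> \<le> z ^ (I + 1)" using that z by (intro power_decreasing) auto
          finally have 1: "(r / t) ^ i \<le> z ^ (I + 1)" .
          have "\<bar>fps_nth \<phi> i\<bar> = \<bar>fps_nth (fps_rescale t (F * V ^ K)) i\<bar> * (r / t) ^ i"
            unfolding \<phi>_def using r t by (simp add: abs_mult power_divide)
          thus ?thesis using 1 by (simp only: mult_left_mono abs_ge_zero)
        qed
        hence "(\<Sum>i\<in>{I<..n}. \<bar>fps_nth \<phi> i\<bar>) \<le> (\<Sum>i\<in>{I<..n}. \<bar>fps_nth (fps_rescale t (F * V ^ K)) i\<bar>) * z ^ (I + 1)"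
          unfolding sum_distrib_right by (intro sum_mono) auto
        also have "\<dots> \<le> (FN * Vt ^ K) * z ^ (I + 1)"
          using z order_trans[OF sum_le_l1_norm[OF lFV, of "{I<..n}"] N] by (intro mult_right_mono) auto
        also have "z ^ (I + 1) \<le> (1 / (2 * Vt)) ^ K"
          unfolding z_def power_mult[symmetric] using IL2 Vt by (intro power_decreasing) auto
        hence "(FN * Vt ^ K) * z ^ (I + 1) \<le> (FN * Vt ^ K) * (1 / (2 * Vt)) ^ K"
          using FN0 Vt by (intro mult_left_mono) auto
        also have "\<dots> = FN * (1 / 2) ^ K" using Vt by (simp add: power_mult_distrib power_divide)
        finally show ?thesis .
      qed
      \<comment> \<open>Up to \<open>I\<close> all terms are nonnegative. Beyond \<open>I\<close>,
        the coefficients \<open>0, ..., J\<close> of \<open>\<phi>\<close> against a renewal window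
        give at least \<open>F0 \<beta> / 4\<close>, more than the tail can cancel.\<close>
      have \<psi>: "0 \<le> fps_nth (\<phi> * d) n" for n
      proof (cases "n \<le> I")
        case True
        show ?thesis unfolding fps_mult_nth
          using True low0 d by (intro sum_nonneg mult_nonneg_nonneg) auto
      next
        case False
        have "F0 * \<beta> / 4 = F0 / 2 * \<beta> * (1 / 2)" by simp
        also have "\<dots> \<le> F0 / 2 * \<beta> * (\<Sum>j\<le>J. fps_nth d (n - j))"
          using False JI F0 \<beta> by (intro mult_left_mono dw) auto
        also have "\<dots> \<le> (\<Sum>j\<le>J. fps_nth \<phi> j * fps_nth d (n - j))"
          unfolding sum_distrib_left using d by (intro sum_mono mult_right_mono lowJ) auto
        also have "\<dots> \<le> (\<Sum>j\<le>I. fps_nth \<phi> j * fps_nth d (n - j))"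
          using JI low0 d by (intro sum_mono2 mult_nonneg_nonneg) auto
        finally have 1: "F0 * \<beta> / 4 \<le> (\<Sum>j\<le>I. fps_nth \<phi> j * fps_nth d (n - j))" .
        have "\<bar>\<Sum>j\<in>{I<..n}. fps_nth \<phi> j * fps_nth d (n - j)\<bar> \<le> (\<Sum>j\<in>{I<..n}. \<bar>fps_nth \<phi> j\<bar> * 1)"
          using d by (intro order_trans[OF sum_abs] sum_mono) (auto simp: abs_mult intro!: mult_left_le)
        also have "\<dots> \<le> FN * (1 / 2) ^ K" using tail by simp
        also have "\<dots> < F0 * \<beta> / 4" using K0 K by simp
        finally have 2: "\<bar>\<Sum>j\<in>{I<..n}. fps_nth \<phi> j * fps_nth d (n - j)\<bar> < F0 * \<beta> / 4" .
        have "{..n} = {..I} \<union> {I<..n}" using False by auto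
        hence "fps_nth (\<phi> * d) n = (\<Sum>j\<in>{..I} \<union> {I<..n}. fps_nth \<phi> j * fps_nth d (n - j))"
          by (simp only: fps_mult_nth atLeast0AtMost)
        also have "\<dots> = (\<Sum>j\<le>I. fps_nth \<phi> j * fps_nth d (n - j)) + (\<Sum>j\<in>{I<..n}. fps_nth \<phi> j * fps_nth d (n - j))"
          by (rule sum.union_disjoint) auto
        finally show ?thesis using 1 2 by linarith
      qed
      have u': "0 \<le> fps_nth u' i" "fps_nth u' 0 = 1" for i using u r0 by (auto simp: u'_def)
      have "0 \<le> fps_nth (\<phi> * u' ^ m) k"
        using coeff_nonneg_of_quotient[OF u' \<kappa>(1) \<psi>[unfolded d_def a_def] k] .
      also have "\<phi> * u' ^ m = fps_rescale r (F * V ^ K * u ^ m)"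
        unfolding \<phi>_def u'_def by (simp add: fps_rescale_mult fps_rescale_power)
      finally have "0 \<le> fps_nth (F * V ^ K * u ^ m) k * r ^ k" by simp
      moreover have "0 < r ^ k" using r by simp
      ultimately show "0 \<le> fps_nth (F * V ^ K * u ^ m) k" by (metis mult_neg_pos not_le)
    qed
  qed
qed

text \<open>\<open>u - X u'\<close> has the coefficients \<open>(1 - n) u_n\<close>, nonpositive for
  \<open>n \<ge> 1\<close>, so its values decrease along \<open>[0, t]\<close>.\<close>

lemma eval_X_deriv_le:
  fixes u :: "real fps"
  assumes u: "\<And>i. 0 \<le> fps_nth u i" "ereal t < fps_conv_radius u" and r: "0 \<le> r" "r \<le> t"
  shows "eval_fps u t - eval_fps (fps_X * fps_deriv u) t \<le> eval_fps u r - eval_fps (fps_X * fps_deriv u) r"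
proof -
  have s: "(\<lambda>n. fps_nth u n * x ^ n - fps_nth (fps_X * fps_deriv u) n * x ^ n) sums
      (eval_fps u x - eval_fps (fps_X * fps_deriv u) x)" if "0 \<le> x" "x \<le> t" for x
  proof -
    have "ereal \<bar>x\<bar> < fps_conv_radius u" using that u(2) by (metis abs_of_nonneg ereal_less_eq(3) le_less_trans)
    thus ?thesis using less_le_trans[OF _ fps_conv_radius_X_deriv]
      by (intro sums_diff sums_eval_fps) auto
  qed
  have "fps_nth u n * t ^ n - fps_nth (fps_X * fps_deriv u) n * t ^ n
     \<le> fps_nth u n * r ^ n - fps_nth (fps_X * fps_deriv u) n * r ^ n" for n
  proof (cases "n = 0")
    case False
    have "(real n - 1) * fps_nth u n * r ^ n \<le> (real n - 1) * fps_nth u n * t ^ n"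
      using False u r by (intro mult_left_mono power_mono mult_nonneg_nonneg) auto
    thus ?thesis unfolding nth_X_times_deriv by (simp add: algebra_simps)
  qed (use u in simp)
  thus ?thesis using r by (intro sums_le[OF _ s s]) auto
qed

text \<open>A positive value forces a positive coefficient, which keeps the value positive at every
  smaller \<open>r > 0\<close>.\<close>

lemma eval_X_deriv_pos:
  fixes u :: "real fps"
  assumes u: "\<And>i. 0 \<le> fps_nth u i" "ereal t < fps_conv_radius u"
    and t: "0 < eval_fps (fps_X * fps_deriv u) t" and r: "0 < r" "r \<le> t"
  shows "0 < eval_fps (fps_X * fps_deriv u) r"
proof -
  let ?p = "fps_X * fps_deriv u"
  have p: "0 \<le> fps_nth ?p n" for n unfolding nth_X_times_deriv using u by simp
  have "\<exists>n. fps_nth ?p n \<noteq> 0"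
  proof (rule ccontr)
    assume "\<not> ?thesis"
    hence p0: "?p = 0" by (intro fps_ext) simp
    show False using t unfolding p0 by simp
  qed
  then obtain n where "0 < fps_nth ?p n" using p by (metis less_eq_real_def)
  hence "0 < fps_nth ?p n * r ^ n" using r by simp
  moreover have s: "(\<lambda>n. fps_nth ?p n * r ^ n) sums eval_fps ?p r"
  proof -
    have "ereal \<bar>r\<bar> < fps_conv_radius u" using r u(2) by (metis abs_of_pos ereal_less_eq(3) le_less_trans)
    thus ?thesis using less_le_trans[OF _ fps_conv_radius_X_deriv] by (intro sums_eval_fps) auto
  qed
  have "(\<Sum>i\<in>{n}. fps_nth ?p i * r ^ i) \<le> (\<Sum>i. fps_nth ?p i * r ^ i)"
    using s p r by (intro sum_le_suminf) (auto simp: sums_iff simp del: nth_X_times_deriv)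
  hence "fps_nth ?p n * r ^ n \<le> eval_fps ?p r" using s by (simp add: sums_iff)
  ultimately show ?thesis by linarith
qed

text \<open>The indices are shared out by saddle point: the top index goes with \<open>r = t\<close>
  and \<open>\<kappa> = 1\<close>, the ratios \<open>k/(m + 1)\<close> up to
  \<open>\<kappa>3\<close> with the single point \<open>r2\<close>, and the others with a point of
  \<open>[r2, rm]\<close> given by the intermediate value theorem.\<close>

lemma coefficients_positive:
  fixes u V F :: "real fps" and t rm :: real
  assumes u: "\<And>i. 0 \<le> fps_nth u i" "fps_nth u 0 = 1" "ereal t < fps_conv_radius u"
    and V: "\<And>i. 0 \<le> fps_nth V i" "fps_nth V 0 = 1" "1 \<le> fps_nth V 1" "ereal t < fps_conv_radius V"
    and F: "ereal t < fps_conv_radius F" "0 < fps_nth F 0" and rm: "0 < rm" "rm \<le> t"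
    and Fpos: "\<And>r. 0 < r \<Longrightarrow> r \<le> rm \<Longrightarrow> 0 < eval_fps F r" "0 < eval_fps F t"
    and crit: "eval_fps (fps_X * fps_deriv u) t = eval_fps u t"
  shows "\<exists>K m0. \<forall>m\<ge>m0. 0 < fps_nth (F * V ^ K * u ^ m) (m + K + 2) \<and>
     (\<forall>k. real k \<le> eval_fps (fps_X * fps_deriv u) rm / eval_fps u rm * (real m + 1) \<longrightarrow>
       0 \<le> fps_nth (F * V ^ K * u ^ m) k)"
proof -
  have t: "0 < t" using rm by simp
  define \<Lambda> where "\<Lambda> = (\<lambda>r. eval_fps (fps_X * fps_deriv u) r / eval_fps u r)"
  have rad: "ereal \<bar>r\<bar> < fps_conv_radius p" if "ereal t < fps_conv_radius p" "0 \<le> r" "r \<le> t" for p :: "real fps" and r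
    using that by (metis abs_of_nonneg ereal_less_eq(3) le_less_trans)
  have u1: "1 \<le> eval_fps u r" if "0 \<le> r" "r \<le> t" for r
    using eval_fps_ge_nth_0[OF u(1) that(1)] rad[OF u(3) that] that u by simp
  have rX: "ereal t < fps_conv_radius (fps_X * fps_deriv u)" using u(3) fps_conv_radius_X_deriv by (rule less_le_trans)
  have \<Lambda>eq: "\<Lambda> r * eval_fps u r = eval_fps (fps_X * fps_deriv u) r" if "0 \<le> r" "r \<le> t" for r
    unfolding \<Lambda>_def using u1[OF that] by simp
  have \<Lambda>1: "\<Lambda> r \<le> 1" if "0 \<le> r" "r \<le> t" for r
    using eval_X_deriv_le[OF u(1,3) that] crit u1[OF that] unfolding \<Lambda>_def by simp
  have \<Lambda>0: "0 < \<Lambda> r" if "0 < r" "r \<le> t" for r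
    using eval_X_deriv_pos[OF u(1,3) _ that] crit u1[of t] u1[of r] that t unfolding \<Lambda>_def by simp
  have cont: "continuous_on {0..t} (eval_fps p)" if "ereal t < fps_conv_radius p" for p :: "real fps"
    using rad[OF that] by (intro continuous_on_subset[OF continuous_on_eval_fps]) auto
  have cont\<Lambda>: "continuous_on {0..t} \<Lambda>"
  proof -
    have "\<forall>r\<in>{0..t}. eval_fps u r \<noteq> 0"
    proof
      fix r assume "r \<in> {0..t}"
      hence "1 \<le> eval_fps u r" by (intro u1) auto
      thus "eval_fps u r \<noteq> 0" by simp
    qed
    thus ?thesis unfolding \<Lambda>_def by (intro continuous_on_divide cont u(3) rX)
  qed
  obtain \<rho> where \<rho>: "0 < \<rho>" and small: "\<And>r \<kappa>. 0 < r \<Longrightarrow> r \<le> \<rho> \<Longrightarrow> r \<le> t \<Longrightarrow> 0 < \<kappa> \<Longrightarrow> \<kappa> \<le> 1 \<Longrightarrow>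
     \<kappa> * eval_fps u r = eval_fps (fps_X * fps_deriv u) r \<Longrightarrow>
     \<exists>K0. \<forall>K\<ge>K0. \<forall>m k. real k \<le> \<kappa> * (real m + 1) \<longrightarrow> 0 \<le> fps_nth (F * V ^ K * u ^ m) k"
    using small_regime[OF u V F t] by blast
  define r2 where "r2 = min \<rho> rm"
  have r2: "0 < r2" "r2 \<le> \<rho>" "r2 \<le> rm" "r2 \<le> t" unfolding r2_def using \<rho> rm by auto
  define \<kappa>3 where "\<kappa>3 = \<Lambda> r2"
  have \<kappa>3: "0 < \<kappa>3" "\<kappa>3 \<le> 1" unfolding \<kappa>3_def using r2 \<Lambda>0[of r2] \<Lambda>1[of r2] by auto
  obtain K0 where K0: "\<forall>K\<ge>K0. \<forall>m k. real k \<le> \<kappa>3 * (real m + 1) \<longrightarrow> 0 \<le> fps_nth (F * V ^ K * u ^ m) k"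
    using small[of r2 \<kappa>3] r2 \<kappa>3 \<Lambda>eq[of r2] unfolding \<kappa>3_def by auto
  \<comment> \<open>A uniform lower bound for \<open>F\<close> at the saddle points in use. The
    point \<open>t\<close> is adjoined separately, as nothing is known about the sign of
    \<open>F\<close> between \<open>rm\<close> and \<open>t\<close>.\<close>
  have "\<exists>x\<in>insert t {r2..rm}. \<forall>y\<in>insert t {r2..rm}. eval_fps F x \<le> eval_fps F y"
  proof (rule continuous_attains_inf)
    show "continuous_on (insert t {r2..rm}) (eval_fps F)"
      using r2 rm by (intro continuous_on_subset[OF cont[OF F(1)]]) auto
  qed (auto intro!: compact_insert)
  then obtain rmin where rmin: "rmin \<in> insert t {r2..rm}" "\<forall>r\<in>insert t {r2..rm}. eval_fps F rmin \<le> eval_fps F r"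
    by (rule bexE)
  define f0 where "f0 = eval_fps F rmin"
  have f0: "0 < f0" unfolding f0_def using rmin(1) Fpos r2 by auto
  obtain K1 where K1: "\<forall>K\<ge>K1. \<exists>m0. \<forall>m\<ge>m0. \<forall>r \<kappa> k. r2 \<le> r \<longrightarrow> r \<le> t \<longrightarrow> f0 \<le> eval_fps F r \<longrightarrow>
     \<kappa>3 \<le> \<kappa> \<longrightarrow> \<kappa> \<le> 1 \<longrightarrow> \<kappa> * eval_fps u r = eval_fps (fps_X * fps_deriv u) r \<longrightarrow>
     \<bar>real k - \<kappa> * (real m + 1)\<bar> \<le> real K + 2 \<longrightarrow> 0 < fps_nth (F * V ^ K * u ^ m) k"
    using middle_regime[OF u V F(1) r2(1,4) f0 \<kappa>3(1)] by blast
  define K where "K = max K0 K1"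
  obtain m0 where m0: "\<forall>m\<ge>m0. \<forall>r \<kappa> k. r2 \<le> r \<longrightarrow> r \<le> t \<longrightarrow> f0 \<le> eval_fps F r \<longrightarrow>
     \<kappa>3 \<le> \<kappa> \<longrightarrow> \<kappa> \<le> 1 \<longrightarrow> \<kappa> * eval_fps u r = eval_fps (fps_X * fps_deriv u) r \<longrightarrow>
     \<bar>real k - \<kappa> * (real m + 1)\<bar> \<le> real K + 2 \<longrightarrow> 0 < fps_nth (F * V ^ K * u ^ m) k"
    using K1[rule_format, of K] unfolding K_def by auto
  show ?thesis
  proof (rule exI[of _ K], rule exI[of _ m0], intro allI impI conjI)
    fix m assume m: "m0 \<le> m"
    \<comment> \<open>The deviation \<open>(m + K + 2) - (m + 1) = K + 1\<close> is within the slack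
      \<open>K + 2\<close>.\<close>
    show "0 < fps_nth (F * V ^ K * u ^ m) (m + K + 2)"
      by (rule m0[rule_format, OF m, of t 1])
         (use r2 rmin(2) \<kappa>3 crit in \<open>auto simp: f0_def\<close>)
    fix k :: nat
    assume "real k \<le> eval_fps (fps_X * fps_deriv u) rm / eval_fps u rm * (real m + 1)"
    hence k: "real k \<le> \<Lambda> rm * (real m + 1)" unfolding \<Lambda>_def .
    show "0 \<le> fps_nth (F * V ^ K * u ^ m) k"
    proof (cases "real k \<le> \<kappa>3 * (real m + 1)")
      case True
      thus ?thesis using K0 unfolding K_def by simp
    next
      case False
      \<comment> \<open>With this ratio the deviation \<open>k - \<kappa> (m + 1)\<close> is
        zero.\<close>
      define \<kappa> where "\<kappa> = real k / (real m + 1)"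
      have \<kappa>: "\<kappa>3 \<le> \<kappa>" "\<kappa> \<le> \<Lambda> rm" unfolding \<kappa>_def using False k
        by (auto simp: pos_divide_le_eq pos_le_divide_eq)
      have "continuous_on {r2..rm} \<Lambda>" using r2 rm by (intro continuous_on_subset[OF cont\<Lambda>]) auto
      then obtain r where r: "r2 \<le> r" "r \<le> rm" "\<Lambda> r = \<kappa>"
        using IVT'[of \<Lambda> r2 \<kappa> rm] \<kappa> r2 unfolding \<kappa>3_def by blast
      have "\<kappa> \<le> 1" using \<Lambda>1[of rm] rm \<kappa> by linarith
      moreover have "f0 \<le> eval_fps F r" using rmin(2) r unfolding f0_def by auto
      moreover have "\<kappa> * eval_fps u r = eval_fps (fps_X * fps_deriv u) r"
        using \<Lambda>eq[of r] r r2 rm by auto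
      moreover have "\<bar>real k - \<kappa> * (real m + 1)\<bar> \<le> real K + 2" unfolding \<kappa>_def by simp
      ultimately have "0 < fps_nth (F * V ^ K * u ^ m) k"
        using m0[rule_format, OF m, of r \<kappa> k] r rm \<kappa> by simp
      thus ?thesis by simp
    qed
  qed
qed

subsection \<open>Values along the real axis and the residue functional\<close>

lemma less_conv_radius_mult:
  "ereal t < fps_conv_radius p \<Longrightarrow> ereal t < fps_conv_radius q \<Longrightarrow> ereal t < fps_conv_radius (p * q)"
  for p q :: "real fps"
  by (rule less_le_trans[OF _ fps_conv_radius_mult]) simp

lemma less_conv_radius_add:
  "ereal t < fps_conv_radius p \<Longrightarrow> ereal t < fps_conv_radius q \<Longrightarrow> ereal t < fps_conv_radius (p + q)"
  for p q :: "real fps"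
  by (rule less_le_trans[OF _ fps_conv_radius_add]) simp

lemma less_conv_radius_diff:
  "ereal t < fps_conv_radius p \<Longrightarrow> ereal t < fps_conv_radius q \<Longrightarrow> ereal t < fps_conv_radius (p - q)"
  for p q :: "real fps"
  by (rule less_le_trans[OF _ fps_conv_radius_diff]) simp

lemma less_conv_radius_abs:
  "ereal t < fps_conv_radius p \<Longrightarrow> 0 \<le> r \<Longrightarrow> r \<le> t \<Longrightarrow> ereal \<bar>r\<bar> < fps_conv_radius p"
  for p :: "real fps"
  by (metis abs_of_nonneg ereal_less_eq(3) le_less_trans)

section \<open>Values of quotients by analytic continuation\<close>

lemma complex_fps_mult: "complex_fps (p * q) = complex_fps p * complex_fps q"
  by (rule fps_ext) (simp add: complex_fps_def fps_mult_nth)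

lemma complex_fps_divide:
  assumes "fps_nth q 0 \<noteq> 0"
  shows "complex_fps (p / q) = complex_fps p / complex_fps q"
proof -
  have q: "fps_nth (complex_fps q) 0 \<noteq> 0" using assms by (simp add: complex_fps_def)
  have "p = p / q * q" using assms by (simp add: fps_divide_unit mult.assoc inverse_mult_eq_1)
  hence "complex_fps p = complex_fps (p / q) * complex_fps q" by (metis complex_fps_mult)
  thus ?thesis using q by (simp add: fps_divide_unit mult.assoc inverse_mult_eq_1')
qed

lemma fps_conv_radius_complex_fps: "fps_conv_radius (complex_fps p) = fps_conv_radius p"
  unfolding fps_conv_radius_def conv_radius_def complex_fps_def by simp

lemma eval_complex_fps:
  assumes "ereal \<bar>x\<bar> < fps_conv_radius p"
  shows "eval_fps (complex_fps p) (complex_of_real x) = complex_of_real (eval_fps p x)"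
proof -
  have "(\<lambda>n. complex_of_real (fps_nth p n * x ^ n)) sums complex_of_real (eval_fps p x)"
    using assms by (intro sums_of_real sums_eval_fps) simp
  thus ?thesis unfolding eval_fps_def complex_fps_def by (simp add: sums_iff)
qed

text \<open>The quotient of the two sums is holomorphic on the common disc minus the zeros of the
  denominator, an open set containing the segment. The series of \<open>p / q\<close> itself may
  diverge at \<open>t\<close>.\<close>

lemma value_at_divide:
  assumes t: "0 < t" and rad: "ereal t < fps_conv_radius p" "ereal t < fps_conv_radius q"
    and q: "\<And>x. 0 \<le> x \<Longrightarrow> x \<le> t \<Longrightarrow> eval_fps q x \<noteq> 0"
  shows "value_at (p / q) t = eval_fps p t / eval_fps q t"
proof (rule value_at_eqI)
  let ?P = "eval_fps (complex_fps p)" and ?Q = "eval_fps (complex_fps q)"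
  define D where "D = eball (0 :: complex) (min (fps_conv_radius p) (fps_conv_radius q))"
  define S where "S = {z \<in> D. ?Q z \<noteq> 0}"
  have D: "D \<subseteq> eball 0 (fps_conv_radius (complex_fps p))" "D \<subseteq> eball 0 (fps_conv_radius (complex_fps q))"
    unfolding D_def fps_conv_radius_complex_fps by (auto intro!: eball_mono)
  have PQ: "?P holomorphic_on D" "?Q holomorphic_on D"
    using D by (auto intro!: holomorphic_on_eval_fps)
  have "S = D \<inter> ?Q -` (- {0})" by (auto simp: S_def)
  also have "open \<dots>"
    using holomorphic_on_imp_continuous_on[OF PQ(2)] by (intro continuous_open_preimage) (auto simp: D_def)
  finally have "open S" .
  moreover have "closed_segment 0 (complex_of_real t) \<subseteq> S"
  proof
    fix z assume z: "z \<in> closed_segment 0 (complex_of_real t)"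
    then obtain s where s: "0 \<le> s" "s \<le> 1" "z = complex_of_real (s * t)"
      by (auto simp: in_segment scaleR_conv_of_real)
    have x: "0 \<le> s * t" "s * t \<le> t" using s t by (auto intro: mult_left_le_one_le)
    hence "z \<in> D"
      using less_conv_radius_abs[OF rad(1) x] less_conv_radius_abs[OF rad(2) x] s t
      by (simp add: D_def abs_mult norm_mult)
    moreover have "?Q z \<noteq> 0"
      using s(3) q[OF x] eval_complex_fps[OF less_conv_radius_abs[OF rad(2) x]] by simp
    ultimately show "z \<in> S" by (simp add: S_def)
  qed
  moreover have "(\<lambda>z. ?P z / ?Q z) holomorphic_on S"
    using PQ unfolding S_def by (auto intro!: holomorphic_on_divide elim: holomorphic_on_subset)
  moreover have "(\<lambda>z. ?P z / ?Q z) has_fps_expansion complex_fps (p / q)"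
  proof -
    have q0: "fps_nth q 0 \<noteq> 0" using q[of 0] t by (simp add: eval_fps_at_0)
    have "0 < fps_conv_radius p" "0 < fps_conv_radius q"
      using t rad by (auto simp: zero_ereal_def[symmetric] intro: order.strict_trans[of 0 "ereal t"])
    moreover have "fps_nth (complex_fps q) 0 \<noteq> 0" using q0 by (simp add: complex_fps_def)
    ultimately show ?thesis unfolding complex_fps_divide[OF q0]
      by (intro has_fps_expansion_divide' eval_fps_has_fps_expansion)
         (simp_all add: fps_conv_radius_complex_fps)
  qed
  moreover have "?P (complex_of_real t) / ?Q (complex_of_real t) = complex_of_real (eval_fps p t / eval_fps q t)"
    using eval_complex_fps[of t p] eval_complex_fps[of t q] rad t by simp
  ultimately show "continues_to (p / q) t (eval_fps p t / eval_fps q t)"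
    unfolding continues_to_def by blast
qed

text \<open>Differentiate \<open>u g = X\<close>, multiply by \<open>X\<close> and use
  \<open>X = u g\<close> again. This exhibits a factor \<open>g\<close>, which is not a unit and so
  is cancelled, not inverted.\<close>

lemma log_deriv_conv:
  assumes "u * g = fps_X" and "fps_nth u 0 = 1"
  shows "log_deriv g = (u - fps_X * fps_deriv u) / u"
proof -
  have g0: "g \<noteq> 0" using assms(1) by auto
  have iu: "u * inverse u = 1" using assms by (intro inverse_mult_eq_1') simp
  have "fps_deriv (u * g) = 1" using assms by simp
  hence d: "u * fps_deriv g = 1 - fps_deriv u * g" by (simp add: algebra_simps)
  have "fps_X * fps_deriv g * u = fps_X * (u * fps_deriv g)" by (simp only: mult_ac)
  also have "\<dots> = u * g - fps_X * fps_deriv u * g" unfolding d by (simp add: right_diff_distrib assms(1)[symmetric] mult_ac)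
  finally have "fps_X * fps_deriv g * u = g * (u - fps_X * fps_deriv u)" by (simp add: algebra_simps)
  hence "fps_X * fps_deriv g * (u * inverse u) = g * ((u - fps_X * fps_deriv u) * inverse u)"
    by (simp only: mult.assoc[symmetric])
  hence "fps_X * fps_deriv g = g * ((u - fps_X * fps_deriv u) * inverse u)" by (simp only: iu mult_1_right)
  hence "log_deriv g = (u - fps_X * fps_deriv u) * inverse u"
    unfolding log_deriv_def using g0 by simp
  thus ?thesis using assms(2) by (simp add: fps_divide_unit)
qed

text \<open>Since \<open>v - t v' = - t\<^sup>2 y'\<close> for \<open>y = v / t\<close>, this says that \<open>y\<^sup>n (y + 1)\<^sup>K y'\<close> has no
  residue.\<close>
lemma annihilate_monomial:
  fixes v :: "real fps"
  assumes "N = i + n + K + 1"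
  shows "fps_nth (fps_X ^ i * v ^ n * (v + fps_X) ^ K * (v - fps_X * fps_deriv v)) N = 0"
  using assms
proof (induction K arbitrary: i n)
  case 0
  have "(v - fps_X * fps_deriv v) * v ^ n = (v - fps_const (1 / 1) * (fps_X * fps_deriv v)) * v ^ n" by simp
  \<comment> \<open>With \<open>\<kappa> = 1\<close> the Euler factor
    \<open>1 - (n + 1)/(n + 1)\<close> vanishes.\<close>
  hence "fps_nth ((v - fps_X * fps_deriv v) * v ^ n) (n + 1) = 0"
    using euler_operator_power_nth[of 1 v n "n + 1"] by (simp only:) simp
  hence "fps_nth (fps_X ^ i * ((v - fps_X * fps_deriv v) * v ^ n)) N = 0"
    using 0 by (simp only: fps_X_power_mult_nth) simp
  also have "fps_X ^ i * ((v - fps_X * fps_deriv v) * v ^ n) = fps_X ^ i * v ^ n * (v + fps_X) ^ 0 * (v - fps_X * fps_deriv v)"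
    by (simp add: mult_ac)
  finally show ?case .
next
  case (Suc K)
  \<comment> \<open>Opening one factor \<open>v + X\<close> raises either \<open>n\<close> or
    \<open>i\<close> by one, so \<open>N\<close> fits the induction hypothesis in both
    cases.\<close>
  have "fps_X ^ i * v ^ n * (v + fps_X) ^ Suc K * (v - fps_X * fps_deriv v)
      = fps_X ^ i * v ^ Suc n * (v + fps_X) ^ K * (v - fps_X * fps_deriv v)
      + fps_X ^ Suc i * v ^ n * (v + fps_X) ^ K * (v - fps_X * fps_deriv v)"
    by (simp add: distrib_left distrib_right mult_ac)
  moreover have "fps_nth (fps_X ^ i * v ^ Suc n * (v + fps_X) ^ K * (v - fps_X * fps_deriv v)) N = 0"
    using Suc by (intro Suc.IH) simp
  moreover have "fps_nth (fps_X ^ Suc i * v ^ n * (v + fps_X) ^ K * (v - fps_X * fps_deriv v)) N = 0"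
    using Suc by (intro Suc.IH) simp
  ultimately show ?case by simp
qed

text \<open>\<open>F\<close> carries the factor \<open>1/h\<close>, and
  \<open>f^(m-i) g^i u^m = X^i v^(m-i)\<close>, so the product is a combination of annihilated
  monomials. The factor \<open>v - w X\<close> raises the power of \<open>v\<close> or of
  \<open>X\<close> by one; both cases lead to the index \<open>m + K + 2\<close>.\<close>

lemma annihilate_admissible:
  fixes f g h u F :: "real fps" and c :: "nat \<Rightarrow> real"
  defines "v \<equiv> f * u"
  assumes ug: "u * g = fps_X"
    and F: "h * F = (v - fps_X * fps_deriv v) * (v - fps_const w * fps_X)"
    and A: "A = h * (\<Sum>i\<le>m. fps_const (c i) * f ^ (m - i) * g ^ i)"
  shows "fps_nth (A * (F * (v + fps_X) ^ K * u ^ m)) (m + K + 2) = 0"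
proof -
  let ?Y = "v - fps_X * fps_deriv v" and ?V = "v + fps_X"
  have tm: "f ^ (m - i) * g ^ i * u ^ m = fps_X ^ i * v ^ (m - i)" if "i \<le> m" for i
  proof -
    have "u ^ m = u ^ i * u ^ (m - i)" using that by (simp flip: power_add)
    hence "f ^ (m - i) * g ^ i * u ^ m = (u * g) ^ i * (f * u) ^ (m - i)"
      by (simp only: power_mult_distrib mult_ac)
    thus ?thesis by (simp only: ug v_def)
  qed
  have "A * (F * ?V ^ K * u ^ m) = (\<Sum>i\<le>m. fps_const (c i) * f ^ (m - i) * g ^ i) * ((h * F) * ?V ^ K * u ^ m)"
    unfolding A by (simp only: mult_ac)
  also have "\<dots> = (\<Sum>i\<le>m. fps_const (c i) * (fps_X ^ i * v ^ Suc (m - i) * ?V ^ K * ?Y)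
      - fps_const (c i * w) * (fps_X ^ Suc i * v ^ (m - i) * ?V ^ K * ?Y))"
    unfolding sum_distrib_right F
  proof (rule sum.cong)
    fix i assume "i \<in> {..m}"
    hence i: "i \<le> m" by simp
    have "fps_const (c i) * f ^ (m - i) * g ^ i * (?Y * (v - fps_const w * fps_X) * ?V ^ K * u ^ m)
        = fps_const (c i) * (f ^ (m - i) * g ^ i * u ^ m) * (v - fps_const w * fps_X) * ?V ^ K * ?Y"
      by (simp only: mult_ac)
    also have "\<dots> = fps_const (c i) * (fps_X ^ i * v ^ Suc (m - i) * ?V ^ K * ?Y)
      - fps_const (c i) * fps_const w * (fps_X ^ Suc i * v ^ (m - i) * ?V ^ K * ?Y)"
      unfolding tm[OF i] by (simp only: right_diff_distrib left_diff_distrib power_Suc mult_ac)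
    finally show "fps_const (c i) * f ^ (m - i) * g ^ i * (?Y * (v - fps_const w * fps_X) * ?V ^ K * u ^ m)
      = fps_const (c i) * (fps_X ^ i * v ^ Suc (m - i) * ?V ^ K * ?Y)
      - fps_const (c i * w) * (fps_X ^ Suc i * v ^ (m - i) * ?V ^ K * ?Y)" by simp
  qed simp
  finally have eq: "A * (F * ?V ^ K * u ^ m) = (\<Sum>i\<le>m. fps_const (c i) * (fps_X ^ i * v ^ Suc (m - i) * ?V ^ K * ?Y)
      - fps_const (c i * w) * (fps_X ^ Suc i * v ^ (m - i) * ?V ^ K * ?Y))" .
  have "fps_nth (fps_X ^ i * v ^ Suc (m - i) * ?V ^ K * ?Y) (m + K + 2) = 0"
    "fps_nth (fps_X ^ Suc i * v ^ (m - i) * ?V ^ K * ?Y) (m + K + 2) = 0" if "i \<le> m" for i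
    using that by (intro annihilate_monomial; simp)+
  thus ?thesis unfolding eq fps_sum_nth fps_sub_nth fps_mult_left_const_nth
    by (intro sum.neutral) simp
qed

text \<open>Strictness comes from comparison with a parabola: in \<open>p - X p'\<close> the terms
  of index 1 cancel, and those from index 2 on shrink at least by \<open>(r/t)^2\<close> on passing
  from \<open>t\<close> to \<open>r\<close>.\<close>

lemma eval_X_deriv_less:
  fixes p :: "real fps"
  assumes p: "\<And>i. 0 \<le> fps_nth p i" "ereal t < fps_conv_radius p" and r: "0 \<le> r" "r < t"
    and less: "eval_fps p t - eval_fps (fps_X * fps_deriv p) t < fps_nth p 0"
  shows "eval_fps p t - eval_fps (fps_X * fps_deriv p) t < eval_fps p r - eval_fps (fps_X * fps_deriv p) r"
proof -
  let ?Y = "\<lambda>x. eval_fps p x - eval_fps (fps_X * fps_deriv p) x"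
  let ?y = "\<lambda>x n. fps_nth p n * x ^ n - fps_nth (fps_X * fps_deriv p) n * x ^ n"
  have s: "(\<lambda>n. ?y x n) sums ?Y x" if "0 \<le> x" "x \<le> t" for x
  proof -
    have "ereal \<bar>x\<bar> < fps_conv_radius p" using that p(2) by (intro less_conv_radius_abs) auto
    thus ?thesis using less_le_trans[OF _ fps_conv_radius_X_deriv]
      by (intro sums_diff sums_eval_fps) auto
  qed
  have z: "(\<lambda>n. if n = 0 then fps_nth p 0 else 0) sums fps_nth p 0"
    using sums_If_finite_set[of "{0}" "\<lambda>_. fps_nth p 0"] by simp
  define w where "w = (r / t)\<^sup>2"
  have w: "0 \<le> w" "w < 1" unfolding w_def using r by (auto simp: power_less_one_iff abs_square_less_1)
  have "w * (?y t n - (if n = 0 then fps_nth p 0 else 0)) \<le> ?y r n - (if n = 0 then fps_nth p 0 else 0)" for n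
  proof (cases "n < 2")
    case True
    hence "n = 0 \<or> n = 1" by auto
    thus ?thesis by (auto simp del: One_nat_def)
  next
    case False
    have "r ^ n = (r / t) ^ n * t ^ n" using r by (simp add: power_divide)
    also have "\<dots> \<le> w * t ^ n"
      unfolding w_def using r False by (intro mult_right_mono power_decreasing) auto
    finally have "(real n - 1) * fps_nth p n * r ^ n \<le> (real n - 1) * fps_nth p n * (w * t ^ n)"
      using False p by (intro mult_left_mono mult_nonneg_nonneg) auto
    thus ?thesis using False unfolding nth_X_times_deriv by (simp add: algebra_simps)
  qed
  hence "w * (?Y t - fps_nth p 0) \<le> ?Y r - fps_nth p 0"
    using r by (intro sums_le[OF _ sums_mult[OF sums_diff[OF s z]] sums_diff[OF s z]]) auto
  moreover have "1 * (?Y t - fps_nth p 0) < w * (?Y t - fps_nth p 0)"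
    using less w by (intro mult_strict_right_mono_neg) auto
  ultimately show ?thesis by simp
qed

section \<open>From coefficient signs to a bound on \<open>max_order\<close>\<close>

lemma nth_eq_0_if_less_valuation: "enat j < valuation p \<Longrightarrow> fps_nth p j = 0"
  unfolding valuation_def by (auto split: if_splits intro: nth_less_subdegree_zero)

text \<open>Since \<open>1/g = u/t\<close>, this transfers the hypotheses on the Laurent series
  \<open>1/g\<close> to the power series \<open>u\<close>.\<close>

lemma reciprocal_fls_nth:
  fixes u g :: "real fps"
  assumes ug: "u * g = fps_X"
  shows "fls_nth (1 / fps_to_fls g) j = fls_nth (fps_to_fls u) (j + 1)"
proof -
  have nz: "fps_to_fls u \<noteq> 0" "fps_to_fls g \<noteq> 0" using ug by auto
  hence "1 / fps_to_fls g = fps_to_fls u / (fps_to_fls u * fps_to_fls g)" by simp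
  also have "\<dots> = fps_to_fls u / fls_X" unfolding fls_times_fps_to_fls[symmetric] ug by simp
  also have "\<dots> = fls_X_inv * fps_to_fls u" by (simp add: fls_inverse_X divide_inverse mult.commute)
  also have "\<dots> = fls_shift 1 (fps_to_fls u)" by (simp add: fls_X_inv_times_conv_shift)
  finally show ?thesis by simp
qed

text \<open>The coefficient of index \<open>N = m + K + 2\<close> of \<open>A\<close> times the test
  series is zero. If \<open>A - 1\<close> had larger valuation, only \<open>j = 0\<close>, with
  positive weight, and indices \<open>j > \<theta> m\<close>, with nonnegative weight, would remain,
  making it positive.\<close>

lemma max_order_le:
  fixes f g h u F :: "real fps" and \<kappa> \<theta> :: real
  defines "v \<equiv> f * u"
  assumes ug: "u * g = fps_X"
    and F: "h * F = (v - fps_X * fps_deriv v) * (v - fps_const w * fps_X)"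
    and top: "0 < fps_nth (F * (v + fps_X) ^ K * u ^ m) (m + K + 2)"
    and low: "\<And>k. real k \<le> \<kappa> * (real m + 1) \<Longrightarrow> 0 \<le> fps_nth (F * (v + fps_X) ^ K * u ^ m) k"
    and \<theta>: "0 \<le> \<theta>" "real m + real K + 2 - \<theta> * m \<le> \<kappa> * (real m + 1)"
  shows "max_order f g h m \<le> enat (nat \<lfloor>\<theta> * m\<rfloor>)"
  unfolding max_order_def
proof (rule SUP_least, rule ccontr)
  fix A assume "A \<in> admissible f g h m" and "\<not> valuation (A - 1) \<le> enat (nat \<lfloor>\<theta> * m\<rfloor>)"
  then obtain c where A: "A = h * (\<Sum>i\<le>m. fps_const (c i) * f ^ (m - i) * g ^ i)"
    and pos: "fps_to_fls A \<succeq> 0" and val: "enat (nat \<lfloor>\<theta> * m\<rfloor>) < valuation (A - 1)"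
    unfolding admissible_def mem_Collect_eq not_le by blast
  let ?P = "F * (v + fps_X) ^ K * u ^ m" and ?N = "m + K + 2"
  have A0: "0 \<le> fps_nth A j" for j
    using pos unfolding fls_succeq_def by (auto dest: spec[of _ "int j"])
  have Aj: "fps_nth (A - 1) j = 0" if "j \<le> nat \<lfloor>\<theta> * m\<rfloor>" for j
    using that val by (intro nth_eq_0_if_less_valuation) (auto intro: le_less_trans[rotated])
  have "0 < fps_nth ?P ?N" by (rule top)
  \<comment> \<open>Here \<open>A\<close> has constant coefficient 1, because the assumed valuation
    of \<open>A - 1\<close> is positive.\<close>
  also have "\<dots> = fps_nth A 0 * fps_nth ?P (?N - 0)" using Aj[of 0] by simp
  also have "\<dots> \<le> (\<Sum>j\<le>?N. fps_nth A j * fps_nth ?P (?N - j))"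
  proof (rule member_le_sum)
    fix j assume j: "j \<in> {..?N} - {0}"
    show "0 \<le> fps_nth A j * fps_nth ?P (?N - j)"
    proof (cases "j \<le> nat \<lfloor>\<theta> * m\<rfloor>")
      case True
      thus ?thesis using Aj[OF True] j by simp
    next
      case False
      hence "\<theta> * m < j" by linarith
      moreover have "real (?N - j) = real m + real K + 2 - real j" using j by (simp add: of_nat_diff)
      ultimately have "real (?N - j) \<le> \<kappa> * (real m + 1)" using \<theta> by linarith
      thus ?thesis using low A0 by simp
    qed
  qed auto
  also have "\<dots> = fps_nth (A * ?P) ?N" by (simp add: fps_mult_nth[of A] atLeast0AtMost)
  also have "\<dots> = 0"
    using annihilate_admissible[OF ug _ A, folded v_def] F by blast
  finally show False by simp
qed

section \<open>Choice of the test series and conclusion\<close>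

theorem theorem1:
  fixes f g h :: "real fps" and t0 t0' :: real
  assumes "fps_conv_radius f > 0" and "fps_conv_radius g > 0" and "fps_conv_radius h > 0"
    and "fps_nth f 0 = 1" and "fps_nth h 0 = 1" and "fps_nth g 0 = 0" and "fps_nth g 1 = 1"
    and "fps_to_fls f \<succeq> 0" and "1 / fps_to_fls g \<succeq> 0"
    and "t0 > 0" and "value_at (log_deriv g) t0 = 0"
    and "\<And>t. 0 < t \<Longrightarrow> t < t0 \<Longrightarrow> value_at (log_deriv g) t \<noteq> 0"
    and "fps_conv_radius f > ereal t0"
    and "fps_conv_radius (fls_regpart (1 / fps_to_fls g)) > ereal t0"
    and "fps_conv_radius (f / h) > ereal t0"
    and "fps_conv_radius (fps_deriv f / h) > ereal t0"
    and "\<And>t. 0 \<le> t \<Longrightarrow> t \<le> t0 \<Longrightarrow> value_at (1 / h) t > 0"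
    and "0 < t0'" and "t0' < t0"
    and "value_at f t0' / value_at g t0' = value_at f t0 / value_at g t0"
  shows "limsup (\<lambda>m. ereal_of_enat (max_order f g h m) / ereal (real m))
           \<le> ereal (value_at (log_deriv g) t0')"
proof -
  note f0 = assms(4) and h0 = assms(5) and t0 = assms(10) and fh = assms(15,16)
    and t0' = assms(18,19) and rf = assms(13)
  \<comment> \<open>\<open>g\<close> is not a unit but \<open>s = g/t\<close> is, and
    \<open>u = t/g\<close> is its inverse.\<close>
  define s where "s = fps_shift 1 g"
  define u where "u = inverse s"
  define v where "v = f * u"
  define V where "V = v + fps_X"
  have s0: "fps_nth s 0 = 1" unfolding s_def using assms(7) by simp
  have g: "g = fps_X * s"
    unfolding s_def using assms(6) by (intro fps_ext) (simp add: fps_X_mult_nth split: nat.split)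
  have us: "u * s = 1" unfolding u_def using s0 by (intro inverse_mult_eq_1) simp
  have "u * g = fps_X * (u * s)" unfolding g by (simp only: mult_ac)
  hence ug: "u * g = fps_X" by (simp only: us mult_1_right)
  have u0: "fps_nth u 0 = 1" unfolding u_def using s0 by simp
  have ru: "ereal t0 < fps_conv_radius u"
  proof -
    \<comment> \<open>The regular part omits the term \<open>1/t\<close> of \<open>1/g\<close>,
      hence the shift; the radius is unaffected.\<close>
    have "fls_regpart (1 / fps_to_fls g) = fps_shift 1 u"
      by (rule fps_ext) (simp add: reciprocal_fls_nth[OF ug] nat_add_distrib)
    thus ?thesis using assms(14) by simp
  qed
  have un: "0 \<le> fps_nth u i" for i
    using assms(9) unfolding fls_succeq_def
    by (auto simp: reciprocal_fls_nth[OF ug] dest: spec[of _ "int i - 1"])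
  have fn: "0 \<le> fps_nth f i" for i
    using assms(8) unfolding fls_succeq_def by (auto dest: spec[of _ "int i"])
  have vn: "0 \<le> fps_nth v i" for i unfolding v_def using fn un by (intro fps_mult_nth_nonneg)
  have v0: "fps_nth v 0 = 1" unfolding v_def using f0 u0 by simp
  have rX: "ereal t0 < fps_conv_radius fps_X" by simp
  have rv: "ereal t0 < fps_conv_radius v" unfolding v_def by (intro less_conv_radius_mult rf ru)
  have rXd: "ereal t0 < fps_conv_radius (fps_X * fps_deriv p)" if "ereal t0 < fps_conv_radius p" for p :: "real fps"
    using that fps_conv_radius_X_deriv by (rule less_le_trans)
  have rV: "ereal t0 < fps_conv_radius V" unfolding V_def by (intro less_conv_radius_add rv rX)
  have at: "ereal (norm r) < fps_conv_radius p" if "ereal t0 < fps_conv_radius p" "0 \<le> r" "r \<le> t0"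
    for p :: "real fps" and r :: real
    using less_conv_radius_abs[OF that] by simp
  have u1: "1 \<le> eval_fps u r" and f1: "1 \<le> eval_fps f r" if "0 \<le> r" "r \<le> t0" for r
    using eval_fps_ge_nth_0[OF un that(1)] eval_fps_ge_nth_0[OF fn that(1)] at[OF ru that] at[OF rf that] that u0 f0
    by auto
  define \<Lambda> where "\<Lambda> = (\<lambda>r. eval_fps (fps_X * fps_deriv u) r / eval_fps u r)"
  \<comment> \<open>\<open>Lg\<close> is a quotient of series that converge up to \<open>t0\<close>,
    though its own series may not.\<close>
  have Lg: "value_at (log_deriv g) r = 1 - \<Lambda> r" if "0 < r" "r \<le> t0" for r
  proof -
    have r: "ereal r < fps_conv_radius u" "ereal r < fps_conv_radius (fps_X * fps_deriv u)"
      using that at[OF ru, of r] at[OF rXd[OF ru], of r] by auto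
    have nz: "eval_fps u x \<noteq> 0" if "0 \<le> x" "x \<le> r" for x
      using u1[of x] that \<open>r \<le> t0\<close> by auto
    have "value_at (log_deriv g) r = eval_fps (u - fps_X * fps_deriv u) r / eval_fps u r"
      unfolding log_deriv_conv[OF ug u0] using r nz that
      by (intro value_at_divide less_conv_radius_diff) auto
    also have "eval_fps (u - fps_X * fps_deriv u) r = eval_fps u r - eval_fps (fps_X * fps_deriv u) r"
      using r that by (intro eval_fps_diff) auto
    finally show ?thesis unfolding \<Lambda>_def using nz[of r] that by (simp add: diff_divide_distrib)
  qed
  have crit: "eval_fps (fps_X * fps_deriv u) t0 = eval_fps u t0"
    using Lg[of t0] assms(11) t0 u1[of t0] by (simp add: \<Lambda>_def)
  have \<Lambda>1: "\<Lambda> r \<le> 1" if "0 \<le> r" "r \<le> t0" for r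
    using eval_X_deriv_le[OF un ru that] crit u1[OF that] unfolding \<Lambda>_def by simp
  define y where "y = (\<lambda>r. eval_fps v r / r)"
  \<comment> \<open>\<open>Y = v - t v' = - t^2 y'\<close>, so its sign decides the monotonicity of
    \<open>y\<close>.\<close>
  define Y where "Y = (\<lambda>r. eval_fps v r - eval_fps (fps_X * fps_deriv v) r)"
  have yval: "value_at f r / value_at g r = y r" if "0 < r" "r \<le> t0" for r
  proof -
    have "inverse u = s" unfolding u_def using s0 by (simp add: fps_inverse_idempotent)
    hence "g = fps_X / u" using u0 by (simp add: g fps_divide_unit)
    moreover have "value_at (fps_X / u) r = eval_fps fps_X r / eval_fps u r"
    proof (rule value_at_divide)
      fix x assume "0 \<le> x" "x \<le> r"
      thus "eval_fps u x \<noteq> 0" using u1[of x] that by auto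
    qed (use that at[OF ru, of r] in auto)
    moreover have "value_at f r = eval_fps f r" using at[OF rf, of r] that by (intro value_at_eq_eval_fps) auto
    moreover have "eval_fps v r = eval_fps f r * eval_fps u r"
      unfolding v_def using at[OF rf, of r] at[OF ru, of r] that by (intro eval_fps_mult) auto
    ultimately show ?thesis unfolding y_def by simp
  qed
  have yeq: "y t0' = y t0" using assms(20) yval[of t0'] yval[of t0] t0' t0 by simp
  have dy: "(y has_real_derivative - Y r / r\<^sup>2) (at r)" if "0 < r" "r \<le> t0" for r
  proof -
    have d: "(eval_fps v has_real_derivative eval_fps (fps_deriv v) r) (at r)"
      using at[OF rv, of r] that by (intro has_field_derivative_eval_fps) auto
    have "((\<lambda>x. eval_fps v x / x) has_real_derivative
        (eval_fps (fps_deriv v) r * r - eval_fps v r * 1) / (r * r)) (at r)"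
      using that by (intro DERIV_divide d DERIV_ident) auto
    moreover have "eval_fps (fps_X * fps_deriv v) r = r * eval_fps (fps_deriv v) r"
      using at[OF less_le_trans[OF rv fps_conv_radius_deriv], of r] that by (subst eval_fps_mult) auto
    ultimately show ?thesis unfolding y_def Y_def by (simp add: power2_eq_square mult.commute)
  qed
  \<comment> \<open>The bound 1 is the value of \<open>Y\<close> at 0; once below it,
    \<open>Y\<close> has decreased strictly.\<close>
  have Yless: "Y t < Y r" if "0 \<le> r" "r < t" "t \<le> t0" "Y t < 1" for r t
    using eval_X_deriv_less[OF vn _ that(1,2)] at[OF rv, of t] that unfolding Y_def v0 by auto
  \<comment> \<open>As \<open>y\<close> takes equal values at \<open>t0'\<close> and
    \<open>t0\<close>, it has a critical point in between.\<close>
  obtain t1 where t1: "t0' < t1" "t1 < t0" "Y t1 = 0"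
  proof -
    have "\<exists>z>t0'. z < t0 \<and> y t0 - y t0' = (t0 - t0') * (- Y z / z\<^sup>2)"
      using t0' by (intro MVT2 dy) auto
    then obtain z where z: "t0' < z" "z < t0" "0 = (t0 - t0') * (- Y z / z\<^sup>2)" using yeq by auto
    hence "Y z = 0" using t0' by simp
    thus thesis using that z by blast
  qed
  have Ypos: "0 < Y r" if "0 \<le> r" "r < t1" for r using Yless[of r t1] that t1 by simp
  \<comment> \<open>Weak monotonicity first gives \<open>Y t0 \<le> 0 < 1\<close>, which makes the
    strict version applicable.\<close>
  have Yneg: "Y t0 < 0"
  proof -
    have "Y t0 \<le> Y t1" unfolding Y_def using t1 t0' by (intro eval_X_deriv_le vn rv) auto
    thus ?thesis using Yless[of t1 t0] t1 t0' by simp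
  qed
  have ydec: "y b < y a" if "0 < a" "a < b" "b \<le> t0'" for a b
  proof -
    have "\<exists>z>a. z < b \<and> y b - y a = (b - a) * (- Y z / z\<^sup>2)"
      using that t0' by (intro MVT2 dy) auto
    then obtain z where z: "a < z" "z < b" "y b - y a = (b - a) * (- Y z / z\<^sup>2)" by auto
    have "0 < Y z / z\<^sup>2" using Ypos[of z] z that t1 by simp
    hence "0 < (b - a) * (Y z / z\<^sup>2)" using that by (intro mult_pos_pos) auto
    thus ?thesis using z by simp
  qed
  define \<theta> where "\<theta> = value_at (log_deriv g) t0'"
  have \<theta>: "\<theta> = 1 - \<Lambda> t0'" unfolding \<theta>_def using Lg t0' by simp
  have \<theta>0: "0 \<le> \<theta>" unfolding \<theta> using \<Lambda>1[of t0'] t0' by simp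
  have eps: "limsup (\<lambda>m. ereal_of_enat (max_order f g h m) / ereal (real m)) \<le> ereal (\<theta> + \<epsilon>)"
    if \<epsilon>: "0 < \<epsilon>" for \<epsilon>
  proof -
    \<comment> \<open>By continuity of \<open>\<Lambda>\<close> at \<open>t0'\<close>. Staying
      strictly left of \<open>t0'\<close> leaves a gap between \<open>y t0'\<close> and
      \<open>y rm\<close>.\<close>
    obtain rm where rm: "0 < rm" "rm < t0'" "1 - \<theta> - \<epsilon> / 2 \<le> \<Lambda> rm"
    proof -
      have "continuous (at t0') (eval_fps u)" "continuous (at t0') (eval_fps (fps_X * fps_deriv u))"
        using at[OF ru, of t0'] at[OF rXd[OF ru], of t0'] t0' by (auto intro!: continuous_eval_fps)
      hence "continuous (at t0') \<Lambda>"
        unfolding \<Lambda>_def using u1[of t0'] t0' by (intro continuous_divide) auto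
      then obtain \<delta> where \<delta>: "0 < \<delta>" "\<And>x. dist x t0' < \<delta> \<Longrightarrow> dist (\<Lambda> x) (\<Lambda> t0') < \<epsilon> / 2"
        unfolding continuous_at_eps_delta using \<epsilon> by (metis half_gt_zero)
      define x where "x = max (t0' / 2) (t0' - \<delta> / 2)"
      have x: "0 < x" "x < t0'" "dist x t0' < \<delta>" unfolding x_def using t0' \<delta>(1) by (auto simp: dist_real_def)
      have "1 - \<theta> - \<epsilon> / 2 \<le> \<Lambda> x" using \<delta>(2)[OF x(3)] unfolding \<theta> dist_real_def by linarith
      thus thesis using that x by blast
    qed
    \<comment> \<open>A level between \<open>y t0' = y t0\<close> and \<open>y rm\<close>: then
      \<open>y - w\<close> is positive on \<open>(0, rm]\<close> and negative at
      \<open>t0\<close>.\<close>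
    define w where "w = (y rm + y t0') / 2"
    have w: "y t0' < w" "w < y rm" unfolding w_def using ydec[of rm t0'] rm by auto
    \<comment> \<open>This is \<open>(v - t v')/h\<close>, written through \<open>f/h\<close> and
      \<open>f'/h\<close>, whose radii are controlled, since \<open>1/h\<close> itself may have a
      smaller radius.\<close>
    define E where "E = f / h * (u - fps_X * fps_deriv u) - fps_X * (fps_deriv f / h * u)"
    define F where "F = E * (v - fps_const w * fps_X)"
    have rE: "ereal t0 < fps_conv_radius E"
      unfolding E_def by (intro less_conv_radius_diff less_conv_radius_mult fh ru rXd rX)
    have rw: "ereal t0 < fps_conv_radius (fps_const w * fps_X)" by (intro less_conv_radius_mult) auto
    have rF: "ereal t0 < fps_conv_radius F"
      unfolding F_def by (intro less_conv_radius_diff less_conv_radius_mult rE rv rw)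
    have hh: "h * inverse h = 1" using h0 by (intro inverse_mult_eq_1') simp
    have dv: "fps_X * fps_deriv v = f * (fps_X * fps_deriv u) + fps_X * fps_deriv f * u"
      unfolding v_def by (simp add: algebra_simps)
    have "h * E = (h * inverse h) * (f * (u - fps_X * fps_deriv u) - fps_X * (fps_deriv f * u))"
      unfolding E_def using h0 by (simp add: fps_divide_unit algebra_simps)
    also have "\<dots> = v - fps_X * fps_deriv v"
      unfolding hh dv by (simp add: v_def algebra_simps)
    finally have hE: "h * E = v - fps_X * fps_deriv v" .
    have hF: "h * F = (v - fps_X * fps_deriv v) * (v - fps_const w * fps_X)"
      unfolding F_def hE[symmetric] by (simp only: mult.assoc)
    \<comment> \<open>Multiplying by \<open>f\<close> allows evaluation through \<open>f/h\<close>;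
      dividing by the nonzero value of \<open>f\<close> afterwards brings in the continued value of
      \<open>1/h\<close>.\<close>
    have fE: "f * E = f / h * (v - fps_X * fps_deriv v)"
    proof -
      have "f / h * (h * E) = f * E * (h * inverse h)" using h0 by (simp add: fps_divide_unit mult_ac)
      thus ?thesis unfolding hE hh by simp
    qed
    have evalF: "eval_fps F r = value_at (1 / h) r * Y r * (r * (y r - w))" if "0 < r" "r \<le> t0" for r
    proof -
      have r: "0 \<le> r" "r \<le> t0" using that by auto
      have fr: "eval_fps f r \<noteq> 0" using f1[OF r] by simp
      have "1 / h = f / h / f"
      proof -
        have "f \<noteq> 0" using f0 by auto
        thus ?thesis using h0 by (simp add: fps_divide_unit)
      qed
      moreover have "value_at (f / h / f) r = eval_fps (f / h) r / eval_fps f r"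
      proof (rule value_at_divide)
        fix x assume "0 \<le> x" "x \<le> r"
        thus "eval_fps f x \<noteq> 0" using f1[of x] that by auto
      qed (use that at[OF rf r] at[OF fh(1) r] in auto)
      ultimately have h1: "value_at (1 / h) r = eval_fps (f / h) r / eval_fps f r" by simp
      have ev: "eval_fps (p * q) r = eval_fps p r * eval_fps q r" "eval_fps (p - q) r = eval_fps p r - eval_fps q r"
        if "ereal t0 < fps_conv_radius p" "ereal t0 < fps_conv_radius q" for p q
        using at[OF that(1) r] at[OF that(2) r] by (auto intro!: eval_fps_mult eval_fps_diff)
      have rY: "ereal t0 < fps_conv_radius (v - fps_X * fps_deriv v)" by (intro less_conv_radius_diff rv rXd)
      have "eval_fps f r * eval_fps E r = eval_fps (f / h) r * Y r"
        using arg_cong[OF fE, of "\<lambda>p. eval_fps p r"]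
        unfolding Y_def ev(1)[OF rf rE] ev(1)[OF fh(1) rY] ev(2)[OF rv rXd[OF rv]] .
      hence "eval_fps E r = value_at (1 / h) r * Y r" unfolding h1 using fr by (simp add: field_simps)
      moreover have "eval_fps (v - fps_const w * fps_X) r = r * (y r - w)"
        unfolding ev(2)[OF rv rw] using that ev(1)[of "fps_const w" fps_X] by (simp add: y_def field_simps)
      ultimately show ?thesis unfolding F_def ev(1)[OF rE less_conv_radius_diff[OF rv rw]] by simp
    qed
    have Fpos: "0 < eval_fps F r" if "0 < r" "r \<le> rm" for r
    proof -
      have "y rm \<le> y r" using ydec[of r rm] that rm by (cases "r = rm") auto
      hence "0 < y r - w" using w by simp
      moreover have "0 < Y r" using Ypos[of r] that rm t1 by simp
      moreover have "0 < value_at (1 / h) r" using assms(17)[of r] that rm t0' by simp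
      ultimately show ?thesis using evalF[of r] that rm t0' by simp
    qed
    \<comment> \<open>At \<open>t0\<close> both \<open>Y\<close> and \<open>y - w\<close> are
      negative, so their signs cancel.\<close>
    have Fpos0: "0 < eval_fps F t0"
    proof -
      have "y t0 - w < 0" using w yeq by simp
      hence "0 < Y t0 * (t0 * (y t0 - w))" using Yneg t0 by (simp add: mult_neg_neg mult_pos_neg)
      moreover have "0 < value_at (1 / h) t0" using assms(17)[of t0] t0 by simp
      ultimately show ?thesis using evalF[of t0] t0 by (simp add: mult.assoc)
    qed
    have F0: "0 < fps_nth F 0"
      unfolding F_def E_def using h0 f0 u0 v0 by (simp add: fps_divide_unit)
    have V1: "1 \<le> fps_nth V 1" "fps_nth V 0 = 1" "0 \<le> fps_nth V i" for i
      unfolding V_def using vn v0 by (auto simp: fps_X_def)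
    obtain K m0 where Km: "\<forall>m\<ge>m0. 0 < fps_nth (F * V ^ K * u ^ m) (m + K + 2) \<and>
       (\<forall>k. real k \<le> \<Lambda> rm * (real m + 1) \<longrightarrow> 0 \<le> fps_nth (F * V ^ K * u ^ m) k)"
      using coefficients_positive[OF un u0 ru V1(3,2,1) rV rF F0 rm(1) _ Fpos Fpos0 crit] rm t0'
      unfolding \<Lambda>_def by auto
    \<comment> \<open>Beyond \<open>m1\<close> the constant \<open>K + 2\<close> is absorbed by
      \<open>\<epsilon> m / 2\<close>; the other half of \<open>\<epsilon> m\<close> pays for
      replacing \<open>t0'\<close> by \<open>rm\<close>.\<close>
    obtain m1 :: nat where m1: "2 * (real K + 2) / \<epsilon> < m1" using reals_Archimedean2 by blast
    have "eventually (\<lambda>m. ereal_of_enat (max_order f g h m) / ereal (real m) \<le> ereal (\<theta> + \<epsilon>)) sequentially"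
      unfolding eventually_sequentially
    proof (intro exI[of _ "Suc (max m0 m1)"] allI impI)
      fix m assume m: "Suc (max m0 m1) \<le> m"
      have "2 * (real K + 2) / \<epsilon> < m" using m1 m by simp
      hence "2 * (real K + 2) < m * \<epsilon>" using \<epsilon> by (simp add: pos_divide_less_eq)
      moreover have "(1 - \<theta> - \<epsilon> / 2) * (real m + 1) \<le> \<Lambda> rm * (real m + 1)"
        using rm by (intro mult_right_mono) auto
      moreover have "0 \<le> \<Lambda> rm"
      proof -
        have "0 \<le> fps_nth (fps_X * fps_deriv u) i" for i unfolding nth_X_times_deriv using un by simp
        from eval_fps_ge_nth_0[OF this, of rm] have "0 \<le> eval_fps (fps_X * fps_deriv u) rm"
          using at[OF rXd[OF ru], of rm] rm t0' by simp
        thus ?thesis unfolding \<Lambda>_def using u1[of rm] rm t0' by simp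
      qed
      moreover have "(1 - \<theta> - \<epsilon> / 2) * real m \<le> \<Lambda> rm * real m"
        using rm by (intro mult_right_mono) auto
      ultimately have bnd: "real m + real K + 2 - (\<theta> + \<epsilon>) * m \<le> \<Lambda> rm * (real m + 1)"
        by (simp add: algebra_simps)
      have "max_order f g h m \<le> enat (nat \<lfloor>(\<theta> + \<epsilon>) * m\<rfloor>)"
        by (rule max_order_le[OF ug hF[unfolded v_def] _ _ _ bnd])
           (use Km m \<theta>0 \<epsilon> in \<open>auto simp: V_def v_def\<close>)
      then obtain i where i: "max_order f g h m = enat i" "i \<le> nat \<lfloor>(\<theta> + \<epsilon>) * m\<rfloor>"
        by (cases "max_order f g h m") auto
      have "0 \<le> (\<theta> + \<epsilon>) * m" using \<theta>0 \<epsilon> by simp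
      hence "real i \<le> (\<theta> + \<epsilon>) * m" using i(2) by linarith
      moreover have "0 < real m" using m by simp
      ultimately show "ereal_of_enat (max_order f g h m) / ereal (real m) \<le> ereal (\<theta> + \<epsilon>)"
        unfolding i(1) by (simp add: pos_divide_le_eq)
    qed
    thus ?thesis by (rule Limsup_bounded)
  qed
  show ?thesis unfolding \<theta>_def[symmetric]
    by (rule ereal_le_epsilon2) (use eps in auto)
qed

end
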